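(* Let $w\in S_n$, and let $u,v\in[e,w]$. If $u\leq_w v$ then $\deg_w(\boldsymbol{u})\leq\deg_w(\boldsymbol{v})$.
   Context: $S_n$ is the symmetric group with Coxeter length $\ell$ and identity $e$. The (strong) Bruhat order $\preceq$ on $S_n$ has cover relations $x \prec xt$ whenever $t$ is a transposition with $\ell(xt)=\ell(x)+1$. Write $[e,w]=\{u\in S_n \mid u\preceq w\}$. For $u\in S_n$ let $\boldsymbol{u}=(u^{-1}(1),\ldots,u^{-1}(n))\in\mathbb{R}^n$. The Bruhat interval polytope of $w$ is $Q_w=\mathrm{Conv}(\{\boldsymbol{u}\mid u\preceq w\})\subset\mathbb{R}^n$; its vertices are exactly the points $\boldsymbol{u}$ with $u\in[e,w]$. The 1-skeleton poset $(P_w,\leq_w)$ has underlying set $[e,w]$ and cover relations $u\lessdot_w v$ whenever $Q_w$ has an edge between $\boldsymbol{u}$ and $\boldsymbol{v}$ and $\ell(v)>\ell(u)$. $\deg_w(\boldsymbol{u})$ denotes the number of edges of $Q_w$ incident to the vertex $\boldsymbol{u}$. *)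

theory Defs
  imports "HOL-Analysis.Analysis" "HOL-Combinatorics.Combinatorics"
begin

text \<open>
  Elements of the symmetric group on \<open>{1..n}\<close> are functions \<open>u :: nat \<Rightarrow> nat\<close> with
  \<open>u permutes {1..n}\<close>; the group product \<open>x t\<close> is \<open>x \<circ> t\<close>.
\<close>

definition coxeter_length :: "nat \<Rightarrow> (nat \<Rightarrow> nat) \<Rightarrow> nat" where
  "coxeter_length n x =
     (LEAST k. \<exists>is. length is = k \<and> set is \<subseteq> {1..<n} \<and>
        x = foldr (\<circ>) (map (\<lambda>i. Transposition.transpose i (Suc i)) is) id)"

definition bruhat_cover :: "nat \<Rightarrow> (nat \<Rightarrow> nat) \<Rightarrow> (nat \<Rightarrow> nat) \<Rightarrow> bool" where
  "bruhat_cover n x y \<longleftrightarrow> x permutes {1..n} \<and>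
     (\<exists>a\<in>{1..n}. \<exists>b\<in>{1..n}. a \<noteq> b \<and> y = x \<circ> Transposition.transpose a b \<and>
        coxeter_length n y = coxeter_length n x + 1)"

definition bruhat_le :: "nat \<Rightarrow> (nat \<Rightarrow> nat) \<Rightarrow> (nat \<Rightarrow> nat) \<Rightarrow> bool" where
  "bruhat_le n = (bruhat_cover n)\<^sup>*\<^sup>*"

definition lower_interval :: "nat \<Rightarrow> (nat \<Rightarrow> nat) \<Rightarrow> (nat \<Rightarrow> nat) set" where
  "lower_interval n w = {u. u permutes {1..n} \<and> bruhat_le n u w}"

text \<open>
  \<open>\<real>\<^sup>n\<close> is \<open>real ^ 'n\<close> with \<open>n = CARD('n)\<close>. The linear order on the index type fixes which
  coordinate is the first, second, ..., last one: \<open>i\<close> is coordinate number \<open>coord_num i\<close>,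
  a value in \<open>{1..n}\<close>.
\<close>

definition coord_num :: "'n::{finite,linorder} \<Rightarrow> nat" where
  "coord_num i = card {..i}"

definition perm_point :: "(nat \<Rightarrow> nat) \<Rightarrow> real ^ 'n::{finite,linorder}" where
  "perm_point u = (\<chi> i. real (inv u (coord_num i)))"

definition bruhat_polytope :: "(nat \<Rightarrow> nat) \<Rightarrow> (real ^ 'n::{finite,linorder}) set" where
  "bruhat_polytope w = convex hull (perm_point ` lower_interval CARD('n) w)"

text \<open>
  The dimension cannot be read off from the permutations alone, so the order on the 1-skeleton
  receives the index type as an explicit argument.
\<close>

definition skeleton_cover ::
    "'n::{finite,linorder} itself \<Rightarrow> (nat \<Rightarrow> nat) \<Rightarrow> (nat \<Rightarrow> nat) \<Rightarrow> (nat \<Rightarrow> nat) \<Rightarrow> bool" where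
  "skeleton_cover N w u v \<longleftrightarrow>
     u \<in> lower_interval CARD('n) w \<and> v \<in> lower_interval CARD('n) w \<and>
     closed_segment (perm_point u) (perm_point v :: real ^ 'n::{finite,linorder}) edge_of bruhat_polytope w \<and>
     coxeter_length CARD('n) v > coxeter_length CARD('n) u"

definition skeleton_le ::
    "'n::{finite,linorder} itself \<Rightarrow> (nat \<Rightarrow> nat) \<Rightarrow> (nat \<Rightarrow> nat) \<Rightarrow> (nat \<Rightarrow> nat) \<Rightarrow> bool" where
  "skeleton_le N w = (skeleton_cover N w)\<^sup>*\<^sup>*"

definition vertex_degree :: "(nat \<Rightarrow> nat) \<Rightarrow> real ^ 'n::{finite,linorder} \<Rightarrow> nat" where
  "vertex_degree w p = card {e. e edge_of bruhat_polytope w \<and> p \<in> e}"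

end

theory Submission imports Defs begin

text \<open>
  Why the degree grows along the skeleton order. A permutation \<open>u\<close> is read in one-line notation:
  the value \<open>u k\<close> stands at position \<open>k\<close>, so that coordinate \<open>x\<close> of the vertex belonging to \<open>u\<close>
  is the position of the value \<open>x\<close>. Let \<open>rnk u k j\<close> count the values \<open>\<ge> j\<close> among the first \<open>k\<close>
  positions. By the tableau criterion \<open>u\<close> lies below \<open>w\<close> exactly when \<open>rnk u \<le> rnk w\<close> pointwise;
  a pair \<open>(k, j)\<close> where the two ranks agree is called tight.

  \<^emph>\<open>Edges at a vertex.\<close> Draw an arc \<open>x \<rightarrow> y\<close> at \<open>u\<close> if \<open>x\<close> stands before \<open>y\<close> and exchanging the
  values \<open>x\<close> and \<open>y\<close> stays in \<open>[e, w]\<close>. For an inversion this is automatic, and for \<open>x < y\<close> it means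
  that no tight pair lies in the rectangle spanned by the two points of the permutation graph. The
  transitive closure of the arcs is a strict partial order. A linear functional whose coefficients
  decrease weakly along arcs is minimal at \<open>u\<close> on the whole polytope (\<open>weight_minimal\<close>): a local
  minimum is a global one. This holds prefix by prefix: an exchange across position \<open>k\<close> that meets
  no tight pair in column \<open>k\<close>, whatever happens in other columns, is a composite of arcs
  (\<open>column_path\<close>), so the first \<open>k\<close> values of \<open>u\<close> have maximal weight. Consequently
  the polytope has, at \<open>u\<close>, one edge for each covering pair of this order (\<open>vertex_degree_eq\<close>),
  because an edge is where a functional is constant along one covering pair and strictly decreasing
  along all other arcs.

  \<^emph>\<open>Monotonicity.\<close> An increasing edge from \<open>u\<close> to \<open>v\<close> exchanges the values \<open>a < b\<close> of a covering
  pair. It raises the rank function by one on the rectangle of \<open>a\<close> and \<open>b\<close> and changes it nowhere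
  else, so tight pairs are only gained, and only inside the rectangle. Identify \<open>a\<close> with \<open>b\<close>. On the
  covering pairs at \<open>u\<close> this identification is injective, since two of them that coincide afterwards
  would form a triangle with \<open>(a, b)\<close>. Every identified covering pair at \<open>u\<close> is also obtained from a
  covering pair at \<open>v\<close>: pairs that avoid \<open>a\<close> and \<open>b\<close> stay covering pairs (\<open>hasse_away\<close>), and if
  \<open>c\<close> is covered by \<open>a\<close> or \<open>b\<close> at \<open>u\<close>, then it is covered by \<open>a\<close> or \<open>b\<close> at \<open>v\<close> (\<open>hasse_into\<close>);
  rotating the picture by a half turn gives the same for covers leaving \<open>{a, b}\<close>. Hence \<open>v\<close> has at
  least as many covering pairs, and edges, as \<open>u\<close> (\<open>card_hasse_le\<close>).
\<close>

section \<open>Inversions and Coxeter length\<close>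

abbreviation swap :: "nat \<Rightarrow> nat \<Rightarrow> nat \<Rightarrow> nat" where
  "swap \<equiv> Transposition.transpose"

definition inversions :: "(nat \<Rightarrow> nat) \<Rightarrow> (nat \<times> nat) set" where
  "inversions x = {(i, j). i < j \<and> x j < x i}"

text \<open>
  Matches pairs of positions before and after a swap of the positions \<open>a < b\<close>. A pair is moved by the
  swap whenever that keeps it increasing; the pairs that stay put are \<open>(a, b)\<close> and those formed by
  \<open>a\<close> or \<open>b\<close> and a position strictly between.
\<close>

definition carry_pair :: "nat \<Rightarrow> nat \<Rightarrow> nat \<times> nat \<Rightarrow> nat \<times> nat" where
  "carry_pair a b = (\<lambda>(i, j).
     if swap a b i < swap a b j then (swap a b i, swap a b j) else (i, j))"

lemma inj_on_carry_pair: "inj_on (carry_pair a b) {(i, j). i < j}"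
proof (rule inj_on_inverseI)
  fix q assume "q \<in> {(i, j). i < (j::nat)}"
  then show "carry_pair a b (carry_pair a b q) = q"
    by (auto simp: carry_pair_def)
qed

text \<open>
  A moved pair carries the same two values as before. A pair that stays put and is an inversion of
  \<open>x\<close> remains one, because the swap puts the larger value \<open>x b\<close> in front and the smaller one behind.
\<close>

lemma carry_pair_inversion:
  assumes "a < b" "x a < x b" "q \<in> inversions x"
  shows "carry_pair a b q \<in> inversions (x \<circ> swap a b) - {(a, b)}"
proof -
  obtain i j where q: "q = (i, j)" "i < j" "x j < x i"
    using assms(3) by (auto simp: inversions_def)
  show ?thesis
  proof (cases "swap a b i < swap a b j")
    case True
    then show ?thesis using q assms(1,2)
      by (auto simp: carry_pair_def inversions_def transpose_eq_iff)
  next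
    case False
    then show ?thesis using q assms(1,2)
      by (auto simp: carry_pair_def inversions_def Transposition.transpose_def split: if_splits)
  qed
qed

lemma inversions_subset:
  assumes "x permutes {1..n}"
  shows "inversions x \<subseteq> {1..n} \<times> {1..n}"
proof
  fix q assume "q \<in> inversions x"
  then obtain i j where q: "q = (i, j)" "i < j" "x j < x i"
    by (auto simp: inversions_def)
  have out: "x k = k" if "k \<notin> {1..n}" for k
    using assms that by (simp add: permutes_def)
  have ins: "x k \<in> {1..n}" if "k \<in> {1..n}" for k
    using permutes_in_image[OF assms] that by blast
  have "j \<in> {1..n}"
  proof (rule ccontr)
    assume j: "j \<notin> {1..n}"
    then have "x j = j" by (rule out)
    moreover have "x i \<le> n \<or> x i = i" using ins out by fastforce
    ultimately show False using q j by auto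
  qed
  moreover have "i \<in> {1..n}"
  proof (rule ccontr)
    assume i: "i \<notin> {1..n}"
    then have "x i = i" by (rule out)
    then show False using q i \<open>j \<in> {1..n}\<close> ins[of j] by auto
  qed
  ultimately show "q \<in> {1..n} \<times> {1..n}" using q by simp
qed

lemma permutes_comp_swap:
  assumes "x permutes {1..n}" "a \<in> {1..n}" "b \<in> {1..n}"
  shows "x \<circ> swap a b permutes {1..n}"
  using assms by (intro permutes_compose permutes_swap_id)

lemma card_inversions_less:
  assumes x: "x permutes {1..n}" and ab: "a \<in> {1..n}" "b \<in> {1..n}" "a < b" "x a < x b"
  shows "card (inversions x) < card (inversions (x \<circ> swap a b))"
proof -
  have fin: "finite (inversions (x \<circ> swap a b))"
    using inversions_subset[OF permutes_comp_swap[OF x ab(1,2)]] finite_subset by blast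
  have "(a, b) \<in> inversions (x \<circ> swap a b)"
    using ab by (simp add: inversions_def)
  moreover have "card (inversions x) \<le> card (inversions (x \<circ> swap a b) - {(a, b)})"
  proof (rule card_inj_on_le)
    show "inj_on (carry_pair a b) (inversions x)"
      by (rule inj_on_subset[OF inj_on_carry_pair]) (auto simp: inversions_def)
    show "carry_pair a b ` inversions x \<subseteq> inversions (x \<circ> swap a b) - {(a, b)}"
      by (intro image_subsetI carry_pair_inversion[OF ab(3,4)])
  qed (use fin in simp)
  ultimately show ?thesis
    using fin by (metis card_Diff1_less le_less_trans)
qed

text \<open>
  If no value between \<open>x a\<close> and \<open>x b\<close> stands between \<open>a\<close> and \<open>b\<close>, the pair \<open>(a, b)\<close> is the only new
  inversion, so the swap is a covering relation.
\<close>

lemma card_inversions_cover: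
  assumes x: "x permutes {1..n}" and ab: "a \<in> {1..n}" "b \<in> {1..n}" "a < b" "x a < x b"
    and between: "\<And>c. a < c \<Longrightarrow> c < b \<Longrightarrow> \<not> (x a < x c \<and> x c < x b)"
  shows "card (inversions (x \<circ> swap a b)) = Suc (card (inversions x))"
proof -
  let ?t = "swap a b"
  have inj: "x i = x j \<longleftrightarrow> i = j" for i j
    using x by (metis permutes_inj inj_eq)
  have sub: "q \<in> carry_pair a b ` inversions x"
    if q: "q \<in> inversions (x \<circ> ?t) - {(a, b)}" for q
  proof -
    obtain i j where ij: "q = (i, j)" "i < j" "x (?t j) < x (?t i)" "(i, j) \<noteq> (a, b)"
      using q by (auto simp: inversions_def)
    show ?thesis
    proof (cases "?t i < ?t j")
      case True
      then have "(?t i, ?t j) \<in> inversions x" using ij by (simp add: inversions_def)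
      moreover have "carry_pair a b (?t i, ?t j) = q" using ij by (simp add: carry_pair_def)
      ultimately show ?thesis by (metis imageI)
    next
      case False
      then have "i = a \<and> a < j \<and> j < b \<or> j = b \<and> a < i \<and> i < b"
        using ij(2,4) ab(3) by (auto simp: Transposition.transpose_def split: if_splits)
      then have "x j < x i"
        using ij(3) between[of i] between[of j] inj[of i b] inj[of j a] ab(3)
        by (auto simp: not_less order.order_iff_strict)
      then have "(i, j) \<in> inversions x" using ij by (simp add: inversions_def)
      moreover have "carry_pair a b (i, j) = q" using ij False by (simp add: carry_pair_def)
      ultimately show ?thesis by (metis imageI)
    qed
  qed
  have "inversions (x \<circ> ?t) - {(a, b)} = carry_pair a b ` inversions x"
    by (intro subset_antisym subsetI sub image_subsetI carry_pair_inversion[OF ab(3,4)])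
  moreover have "card (carry_pair a b ` inversions x) = card (inversions x)"
    by (intro card_image inj_on_subset[OF inj_on_carry_pair]) (auto simp: inversions_def)
  moreover have "(a, b) \<in> inversions (x \<circ> ?t)"
    using ab by (simp add: inversions_def)
  moreover have "finite (inversions (x \<circ> ?t))"
    using inversions_subset[OF permutes_comp_swap[OF x ab(1,2)]] finite_subset by blast
  ultimately show ?thesis
    by (metis card_Suc_Diff1)
qed

definition word_prod :: "nat list \<Rightarrow> nat \<Rightarrow> nat" where
  "word_prod ss = foldr (\<circ>) (map (\<lambda>i. swap i (Suc i)) ss) id"

lemma word_prod_Nil: "word_prod [] = id"
  by (simp add: word_prod_def)

lemma word_prod_snoc: "word_prod (ss @ [i]) = word_prod ss \<circ> swap i (Suc i)"
proof -
  have "foldr (\<circ>) fs g = foldr (\<circ>) fs id \<circ> g" for fs and g :: "nat \<Rightarrow> nat"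
    by (induction fs) (auto simp: comp_assoc)
  from this[of "map (\<lambda>i. swap i (Suc i)) ss" "swap i (Suc i)"]
  show ?thesis by (simp add: word_prod_def)
qed

lemma word_prod_permutes:
  "set ss \<subseteq> {1..<n} \<Longrightarrow> word_prod ss permutes {1..n}"
proof (induction ss rule: rev_induct)
  case Nil
  show ?case unfolding word_prod_Nil by (rule permutes_id)
next
  case (snoc i ss)
  then have "word_prod ss permutes {1..n}" "i \<in> {1..n}" "Suc i \<in> {1..n}" by auto
  then show ?case unfolding word_prod_snoc by (rule permutes_comp_swap)
qed

lemma card_inversions_adjacent:
  assumes "x permutes {1..n}" "i \<in> {1..<n}"
  shows "x i < x (Suc i) \<Longrightarrow> card (inversions (x \<circ> swap i (Suc i))) = Suc (card (inversions x))"
    and "x (Suc i) < x i \<Longrightarrow> card (inversions x) = Suc (card (inversions (x \<circ> swap i (Suc i))))"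
proof -
  show "card (inversions (x \<circ> swap i (Suc i))) = Suc (card (inversions x))"
    if "x i < x (Suc i)"
    using card_inversions_cover[of x n i "Suc i"] assms that by auto
  show "card (inversions x) = Suc (card (inversions (x \<circ> swap i (Suc i))))"
    if "x (Suc i) < x i"
  proof -
    let ?y = "x \<circ> swap i (Suc i)"
    have "?y permutes {1..n}" using assms by (intro permutes_comp_swap) auto
    then have "card (inversions (?y \<circ> swap i (Suc i))) = Suc (card (inversions ?y))"
      using card_inversions_cover[of ?y n i "Suc i"] assms that by auto
    then show ?thesis by (simp add: comp_assoc)
  qed
qed

lemma card_inversions_word_prod:
  "set ss \<subseteq> {1..<n} \<Longrightarrow> card (inversions (word_prod ss)) \<le> length ss"
proof (induction ss rule: rev_induct)
  case Nil
  have "inversions (word_prod []) = {}" by (auto simp: inversions_def word_prod_Nil)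
  then show ?case by simp
next
  case (snoc i ss)
  then have "word_prod ss permutes {1..n}" "i \<in> {1..<n}"
    using word_prod_permutes[of ss n] by auto
  note adj = card_inversions_adjacent[OF this]
  have "word_prod ss i \<noteq> word_prod ss (Suc i)"
    using \<open>word_prod ss permutes {1..n}\<close> by (metis n_not_Suc_n permutes_inj inj_eq)
  then show ?case using adj snoc by (subst word_prod_snoc) fastforce
qed

lemma increasing_permutation_is_id:
  assumes x: "x permutes {1..n}" and up: "\<And>i. i \<in> {1..<n} \<Longrightarrow> x i < x (Suc i)"
  shows "x = id"
proof -
  have out: "x k = k" if "k \<notin> {1..n}" for k
    using x that by (simp add: permutes_def)
  have ins: "x k \<in> {1..n}" if "k \<in> {1..n}" for k
    using permutes_in_image[OF x] that by blast
  have lower: "1 \<le> i \<Longrightarrow> i \<le> n \<Longrightarrow> i \<le> x i" for i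
  proof (induction i rule: nat_induct_at_least)
    case base
    then show ?case using ins[of 1] by simp
  next
    case (Suc i)
    then show ?case using up[of i] by simp
  qed
  have upper: "i \<le> n \<Longrightarrow> 1 \<le> i \<Longrightarrow> x i \<le> i" for i
  proof (induction i rule: inc_induct)
    case base
    then show ?case using ins[of n] by simp
  next
    case (step i)
    then show ?case using up[of i] by simp
  qed
  show ?thesis
  proof
    fix i
    show "x i = id i"
      using lower[of i] upper[of i] out[of i] by (cases "i \<in> {1..n}") auto
  qed
qed

text \<open>
  Sorting \<open>x\<close> by swaps of adjacent descents removes one inversion at a time, which yields a word whose
  length is the number of inversions.
\<close>

lemma exists_word:
  "x permutes {1..n} \<Longrightarrow>
   \<exists>ss. length ss = card (inversions x) \<and> set ss \<subseteq> {1..<n} \<and> x = word_prod ss"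
proof (induction "card (inversions x)" arbitrary: x rule: less_induct)
  case less
  show ?case
  proof (cases "\<exists>i\<in>{1..<n}. x (Suc i) < x i")
    case True
    then obtain i where i: "i \<in> {1..<n}" "x (Suc i) < x i" by blast
    let ?y = "x \<circ> swap i (Suc i)"
    have y: "?y permutes {1..n}" using i less.prems by (intro permutes_comp_swap) auto
    have c: "card (inversions x) = Suc (card (inversions ?y))"
      using card_inversions_adjacent(2)[OF less.prems i] .
    then obtain ss where ss: "length ss = card (inversions ?y)" "set ss \<subseteq> {1..<n}" "?y = word_prod ss"
      using less.hyps[OF _ y] by auto
    have "x = ?y \<circ> swap i (Suc i)" by (simp add: comp_assoc)
    also have "\<dots> = word_prod (ss @ [i])" using ss(3) by (simp only: word_prod_snoc)
    finally have "x = word_prod (ss @ [i])" .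
    moreover have "length (ss @ [i]) = card (inversions x)" "set (ss @ [i]) \<subseteq> {1..<n}"
      using ss(1,2) c i by auto
    ultimately show ?thesis by blast
  next
    case False
    have "x i \<noteq> x (Suc i)" for i
      using less.prems by (metis n_not_Suc_n permutes_inj inj_eq)
    with False have "x = id"
      using increasing_permutation_is_id[OF less.prems] by (metis linorder_neqE_nat)
    moreover have "inversions id = {}" by (auto simp: inversions_def)
    ultimately show ?thesis by (intro exI[of _ "[]"]) (simp add: word_prod_Nil)
  qed
qed

lemma coxeter_length_eq_inversions:
  assumes "x permutes {1..n}"
  shows "coxeter_length n x = card (inversions x)"
  unfolding coxeter_length_def word_prod_def[symmetric]
proof (rule Least_equality)
  show "\<exists>ss. length ss = card (inversions x) \<and> set ss \<subseteq> {1..<n} \<and> x = word_prod ss"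
    by (rule exists_word[OF assms])
  show "card (inversions x) \<le> k"
    if "\<exists>ss. length ss = k \<and> set ss \<subseteq> {1..<n} \<and> x = word_prod ss" for k
    using that card_inversions_word_prod by auto
qed

section \<open>The tableau criterion for the Bruhat order\<close>

text \<open>
  Positions are counted from 1. Writing the count as a sum makes it compute by recursion on \<open>k\<close>.
\<close>

definition rnk :: "(nat \<Rightarrow> nat) \<Rightarrow> nat \<Rightarrow> nat \<Rightarrow> nat" where
  "rnk u k j = (\<Sum>i\<in>{1..k}. of_bool (j \<le> u i))"

definition dominated :: "(nat \<Rightarrow> nat) \<Rightarrow> (nat \<Rightarrow> nat) \<Rightarrow> bool" where
  "dominated u w \<longleftrightarrow> (\<forall>k j. rnk u k j \<le> rnk w k j)"

lemma rnk_0 [simp]: "rnk u 0 j = 0"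
  by (simp add: rnk_def)

lemma rnk_Suc: "rnk u (Suc k) j = rnk u k j + of_bool (j \<le> u (Suc k))"
  by (simp add: rnk_def)

lemma dominatedD: "dominated u w \<Longrightarrow> rnk u k j \<le> rnk w k j"
  by (simp add: dominated_def)

lemma dominated_refl: "dominated u u"
  by (simp add: dominated_def)

lemma dominated_trans: "dominated u v \<Longrightarrow> dominated v w \<Longrightarrow> dominated u w"
  unfolding dominated_def using le_trans by blast

text \<open>
  Swapping an ascent raises the rank function by one exactly on the rectangle spanned by the two
  points of the permutation graph.
\<close>

lemma rnk_swap:
  assumes "1 \<le> p" "p < q" "u p < u q"
  shows "rnk (u \<circ> swap p q) k j = rnk u k j + of_bool (p \<le> k \<and> k < q \<and> u p < j \<and> j \<le> u q)"
proof (induction k)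
  case 0
  then show ?case using assms by simp
next
  case (Suc k)
  consider "Suc k = p" | "Suc k = q" | "Suc k \<noteq> p" "Suc k \<noteq> q" by blast
  then show ?case
  proof cases
    case 1
    then show ?thesis using Suc assms by (auto simp: rnk_Suc)
  next
    case 2
    then show ?thesis using Suc assms by (auto simp: rnk_Suc)
  next
    case 3
    then show ?thesis using Suc assms by (auto simp: rnk_Suc)
  qed
qed

lemma dominated_swap:
  assumes "1 \<le> p" "p < q" "u p < u q"
  shows "dominated u (u \<circ> swap p q)"
  using rnk_swap[of p q u] assms by (simp add: dominated_def)

lemma bruhat_cover_increasing:
  assumes "bruhat_cover n x y"
  obtains a b where "a \<in> {1..n}" "b \<in> {1..n}" "a < b" "x a < x b" "y = x \<circ> swap a b"
proof -
  obtain a b where x: "x permutes {1..n}" and ab: "a \<in> {1..n}" "b \<in> {1..n}" "a < b"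
    and y: "y = x \<circ> swap a b" and len: "coxeter_length n y = coxeter_length n x + 1"
  proof -
    obtain a b where *: "x permutes {1..n}" "a \<in> {1..n}" "b \<in> {1..n}" "a \<noteq> b" "y = x \<circ> swap a b"
      "coxeter_length n y = coxeter_length n x + 1"
      using assms unfolding bruhat_cover_def by blast
    then have "y = x \<circ> swap b a" by (simp add: transpose_commute)
    with * that[of a b] that[of b a] show ?thesis by (metis linorder_neqE_nat)
  qed
  have perm: "y permutes {1..n}" using x y ab permutes_comp_swap by simp
  have "x a < x b"
  proof (rule ccontr)
    assume "\<not> x a < x b"
    moreover have "x a \<noteq> x b" using ab x by (metis permutes_inj inj_eq less_irrefl)
    ultimately have "y a < y b" by (simp add: y)
    from card_inversions_less[OF perm ab this]
    moreover have "y \<circ> swap a b = x" by (simp add: y comp_assoc)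
    ultimately have "card (inversions y) < card (inversions x)" by (simp only:)
    then show False using len x perm by (simp add: coxeter_length_eq_inversions)
  qed
  then show thesis using that ab y by blast
qed

lemma bruhat_le_imp_dominated:
  assumes "bruhat_le n u w"
  shows "dominated u w"
  using assms unfolding bruhat_le_def
proof (induction rule: rtranclp_induct)
  case base
  show ?case by (rule dominated_refl)
next
  case (step x y)
  obtain a b where "a \<in> {1..n}" "a < b" "x a < x b" "y = x \<circ> swap a b"
    using bruhat_cover_increasing[OF step.hyps(2)] by metis
  then have "dominated x y" by (simp add: dominated_swap)
  with step.IH show ?case by (rule dominated_trans)
qed

text \<open>
  The substantial half of the tableau criterion: one covering step from \<open>u\<close> towards \<open>w\<close>. At the
  first position \<open>p\<close> where the two differ, \<open>u p < w p\<close>. Swap it with the first later position \<open>q\<close>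
  whose value lies in the interval from \<open>u p\<close> to \<open>w p\<close>. Minimality of \<open>q\<close> makes the step a cover,
  and it leaves enough room below \<open>rnk w\<close> on the rectangle of the swap.
\<close>

lemma dominated_cover:
  assumes u: "u permutes {1..n}" and w: "w permutes {1..n}"
    and dom: "dominated u w" and neq: "u \<noteq> w"
  obtains v where "bruhat_cover n u v" "v permutes {1..n}" "dominated v w"
    "card (inversions v) = Suc (card (inversions u))"
proof -
  define p where "p = (LEAST i. u i \<noteq> w i)"
  have ex: "\<exists>i. u i \<noteq> w i" using neq by auto
  have up: "u p \<noteq> w p" unfolding p_def using LeastI_ex[OF ex] .
  have eq: "u i = w i" if "i < p" for i
    using not_less_Least[of i "\<lambda>i. u i \<noteq> w i"] that unfolding p_def by blast
  have p: "p \<in> {1..n}" using up u w by (metis permutes_not_in)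
  have rnk_eq: "rnk u (p - 1) j = rnk w (p - 1) j" for j
    unfolding rnk_def using eq by (intro sum.cong) auto
  have rnk_p: "rnk v p j = rnk v (p - 1) j + of_bool (j \<le> v p)" for v j
    using p rnk_Suc[of v "p - 1" j] by simp
  have "u p < w p"
    using dominatedD[OF dom, of p "u p"] up rnk_eq[of "u p"] by (auto simp: rnk_p of_bool_def split: if_splits)
  define P where "P q \<longleftrightarrow> p < q \<and> u p < u q \<and> u q \<le> w p" for q
  have exP: "\<exists>q. P q"
  proof -
    define q where "q = inv u (w p)"
    have uq: "u q = w p" using u unfolding q_def by (simp add: permutes_inverses)
    have "\<not> q < p"
    proof
      assume "q < p"
      then have "w q = w p" using uq eq by simp
      then show False using \<open>q < p\<close> w by (metis permutes_inj inj_eq less_irrefl)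
    qed
    moreover have "q \<noteq> p" using uq up by auto
    ultimately show ?thesis unfolding P_def using uq \<open>u p < w p\<close> by (intro exI[of _ q]) auto
  qed
  define q where "q = (LEAST q. P q)"
  have q: "p < q" "u p < u q" "u q \<le> w p"
    using LeastI_ex[OF exP] unfolding q_def[symmetric] by (auto simp: P_def)
  have least: "\<not> P c" if "c < q" for c
    using not_less_Least that unfolding q_def by blast
  have qn: "q \<in> {1..n}"
  proof (rule ccontr)
    assume "q \<notin> {1..n}"
    then have "u q = q" using u by (simp add: permutes_not_in)
    moreover have "w p \<in> {1..n}" using permutes_in_image[OF w] p by blast
    ultimately show False using q p \<open>q \<notin> {1..n}\<close> by auto
  qed
  define v where "v = u \<circ> swap p q"
  have v: "v permutes {1..n}" unfolding v_def using u p qn by (rule permutes_comp_swap)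
  have c: "card (inversions v) = Suc (card (inversions u))"
    unfolding v_def using least q u p qn
    by (intro card_inversions_cover[where n = n]) (fastforce simp: P_def)+
  have "coxeter_length n v = coxeter_length n u + 1"
    using coxeter_length_eq_inversions u v c by simp
  then have "bruhat_cover n u v"
    unfolding bruhat_cover_def using u p qn q(1) v_def by (metis less_irrefl)
  moreover have "dominated v w"
    unfolding dominated_def
  proof (intro allI)
    fix k j
    show "rnk v k j \<le> rnk w k j"
    proof (cases "p \<le> k \<and> k < q \<and> u p < j \<and> j \<le> u q")
      case True
      let ?J = "Suc (w p)"
      have "p \<le> k" "k < q" using True by auto
      \<comment> \<open>From position \<open>p\<close> up to \<open>q\<close>, the values of \<open>u\<close> that are \<open>\<ge> j\<close> already exceed \<open>w p\<close>, while \<open>w p\<close> itself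
        is counted for \<open>j\<close> and not for \<open>w p + 1\<close>; so one unit of room at \<open>j\<close> is inherited from \<open>w p + 1\<close>.\<close>
      then have "rnk u k j + rnk w k ?J + 1 \<le> rnk w k j + rnk u k ?J"
      proof (induction k rule: dec_induct)
        case base
        then show ?case
          using True q(3) rnk_eq \<open>u p < w p\<close> by (simp add: rnk_p)
      next
        case (step i)
        have "\<not> P (Suc i)" using step least by simp
        then have "of_bool (j \<le> u (Suc i)) = (of_bool (?J \<le> u (Suc i)) :: nat)"
          using True q(3) step unfolding P_def by auto
        moreover have "(of_bool (?J \<le> w (Suc i)) :: nat) \<le> of_bool (j \<le> w (Suc i))"
          using True q(3) by auto
        ultimately show ?case using step by (simp add: rnk_Suc)
      qed
      moreover have "rnk u k ?J \<le> rnk w k ?J" by (rule dominatedD[OF dom])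
      moreover have "rnk v k j = rnk u k j + 1"
        unfolding v_def using rnk_swap[of p q u k j] p q True by simp
      ultimately show ?thesis by simp
    next
      case False
      then have "rnk v k j = rnk u k j"
        unfolding v_def using rnk_swap[of p q u k j] p q by auto
      then show ?thesis using dominatedD[OF dom] by simp
    qed
  qed
  ultimately show thesis using that v c by blast
qed

lemma dominated_imp_bruhat_le:
  assumes "u permutes {1..n}" "w permutes {1..n}" "dominated u w"
  shows "bruhat_le n u w"
  using assms
proof (induction "n * n - card (inversions u)" arbitrary: u rule: less_induct)
  case less
  show ?case
  proof (cases "u = w")
    case True
    then show ?thesis by (simp add: bruhat_le_def)
  next
    case False
    then obtain v where v: "bruhat_cover n u v" "v permutes {1..n}" "dominated v w"
      "card (inversions v) = Suc (card (inversions u))"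
      using dominated_cover less.prems by metis
    have "card (inversions v) \<le> n * n"
      using card_mono[OF _ inversions_subset[OF v(2)]] by simp
    then have "n * n - card (inversions v) < n * n - card (inversions u)"
      using v(4) by simp
    then have "bruhat_le n v w" using less.hyps v less.prems by blast
    with v(1) show ?thesis unfolding bruhat_le_def by (rule converse_rtranclp_into_rtranclp)
  qed
qed

lemma lower_interval_eq:
  assumes "w permutes {1..n}"
  shows "lower_interval n w = {u. u permutes {1..n} \<and> dominated u w}"
  using assms bruhat_le_imp_dominated dominated_imp_bruhat_le
  unfolding lower_interval_def by blast

section \<open>Hasse diagrams before and after an increasing exchange\<close>

text \<open>
  The points \<open>(pos x, val x)\<close> form a permutation graph and \<open>T\<close> is a set of obstructions. For an
  inversion the rectangle is empty, so that inversions are always arcs. Integers are used so that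
  the picture can be rotated by a half turn.
\<close>

definition exch_arc :: "('a \<Rightarrow> int) \<Rightarrow> ('a \<Rightarrow> int) \<Rightarrow> (int \<times> int) set \<Rightarrow> 'a \<Rightarrow> 'a \<Rightarrow> bool" where
  "exch_arc pos val T x y \<longleftrightarrow> pos x < pos y \<and>
     (\<forall>k j. pos x \<le> k \<and> k < pos y \<and> val x < j \<and> j \<le> val y \<longrightarrow> (k, j) \<notin> T)"

definition hasse :: "('a \<Rightarrow> 'a \<Rightarrow> bool) \<Rightarrow> 'a \<Rightarrow> 'a \<Rightarrow> bool" where
  "hasse r x y \<longleftrightarrow> r\<^sup>+\<^sup>+ x y \<and> (\<nexists>z. r\<^sup>+\<^sup>+ x z \<and> r\<^sup>+\<^sup>+ z y)"

text \<open>
  The half turn acting on obstructions. The shifts by one account for rectangles being half-open, on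
  the right in the first coordinate and on the left in the second.
\<close>

definition rotate_tight :: "(int \<times> int) set \<Rightarrow> (int \<times> int) set" where
  "rotate_tight T = {(k, j). (- k - 1, 1 - j) \<in> T}"

lemma arc_pos: "(exch_arc pos val T)\<^sup>+\<^sup>+ x y \<Longrightarrow> pos x < pos y"
  by (induction rule: tranclp_induct) (auto simp: exch_arc_def)

lemma arc_rotate:
  "exch_arc (\<lambda>x. - pos x) (\<lambda>x. - val x) (rotate_tight T) x y \<longleftrightarrow> exch_arc pos val T y x"
proof -
  have "(\<forall>k j. - pos x \<le> k \<and> k < - pos y \<and> - val x < j \<and> j \<le> - val y \<longrightarrow> (- k - 1, 1 - j) \<notin> T) \<longleftrightarrow>
    (\<forall>k j. pos y \<le> k \<and> k < pos x \<and> val y < j \<and> j \<le> val x \<longrightarrow> (k, j) \<notin> T)" (is "?L \<longleftrightarrow> ?R")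
  proof
    assume L: ?L
    show ?R
    proof (intro allI impI)
      fix k j
      show "pos y \<le> k \<and> k < pos x \<and> val y < j \<and> j \<le> val x \<Longrightarrow> (k, j) \<notin> T"
        using L[rule_format, of "- k - 1" "1 - j"] by simp
    qed
  next
    assume R: ?R
    show ?L
    proof (intro allI impI)
      fix k j
      show "- pos x \<le> k \<and> k < - pos y \<and> - val x < j \<and> j \<le> - val y \<Longrightarrow> (- k - 1, 1 - j) \<notin> T"
        using R[rule_format, of "- k - 1" "1 - j"] by simp
    qed
  qed
  then show ?thesis by (auto simp: exch_arc_def rotate_tight_def)
qed

lemma arc_rotate_eq: "exch_arc (\<lambda>x. - pos x) (\<lambda>x. - val x) (rotate_tight T) = (exch_arc pos val T)\<inverse>\<inverse>"
  by (intro ext) (simp add: arc_rotate)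

lemma hasse_converse: "hasse (r\<inverse>\<inverse>) x y \<longleftrightarrow> hasse r y x"
  unfolding hasse_def tranclp_converse by auto

lemma hasse_imp_step: "hasse r x y \<Longrightarrow> r x y"
  unfolding hasse_def by (metis tranclp.cases tranclp.r_into_trancl)

text \<open>
  Two configurations that differ by exchanging the points \<open>a\<close> and \<open>b\<close>, a covering pair in which \<open>b\<close> lies
  to the upper right of \<open>a\<close>. The obstructions grow, but only inside the rectangle of \<open>a\<close> and \<open>b\<close>. The
  last assumption says that after the exchange a relation follows from a single free column.
\<close>

locale up_step =
  fixes pos val :: "'a \<Rightarrow> int" and T T' :: "(int \<times> int) set" and a b :: 'a
    and pos' :: "'a \<Rightarrow> int"
  assumes pos'_def: "pos' = pos \<circ> Transposition.transpose a b"
    and inj_pos: "inj pos" and inj_val: "inj val"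
    and val_ab: "val a < val b"
    and hasse_ab: "hasse (exch_arc pos val T) a b"
    and T_subset: "T \<subseteq> T'"
    and T'_subset: "T' \<subseteq> T \<union> {pos a..<pos b} \<times> {val a<..val b}"
    and column: "\<And>x y k. pos' x \<le> k \<Longrightarrow> k < pos' y \<Longrightarrow> (\<And>j. val x < j \<Longrightarrow> j \<le> val y \<Longrightarrow> (k, j) \<notin> T')
      \<Longrightarrow> (exch_arc pos' val T')\<^sup>+\<^sup>+ x y"
begin

abbreviation A where "A \<equiv> exch_arc pos val T"
abbreviation A' where "A' \<equiv> exch_arc pos' val T'"
abbreviation P where "P \<equiv> A\<^sup>+\<^sup>+"
abbreviation P' where "P' \<equiv> A'\<^sup>+\<^sup>+"

lemma pos'_simps [simp]: "pos' a = pos b" "pos' b = pos a" "x \<noteq> a \<Longrightarrow> x \<noteq> b \<Longrightarrow> pos' x = pos x"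
  by (auto simp: pos'_def)

lemma arc_ab: "A a b"
  using hasse_ab by (rule hasse_imp_step)

lemma pos_ab: "pos a < pos b"
  using arc_ab by (simp add: exch_arc_def)

lemma ab_neq [simp]: "a \<noteq> b" "b \<noteq> a"
  using pos_ab by auto

lemma pos_eq [simp]: "pos x = pos y \<longleftrightarrow> x = y"
  using inj_pos by (auto dest: injD)

lemma val_eq [simp]: "val x = val y \<longleftrightarrow> x = y"
  using inj_val by (auto dest: injD)

lemma P_trans: "P x y \<Longrightarrow> P y z \<Longrightarrow> P x z"
  by (rule tranclp_trans)

lemma nothing_between: "P a z \<Longrightarrow> P z b \<Longrightarrow> False"
  using hasse_ab by (auto simp: hasse_def)

lemma no_point_in_rectangle:
  assumes "pos a < pos z" "pos z < pos b" "val a < val z" "val z < val b"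
  shows False
proof -
  have "A a z" "A z b" using arc_ab assms by (auto simp: exch_arc_def)
  then show False using nothing_between by blast
qed

lemma below_rectangle:
  assumes "pos a < pos z" "pos z < pos b" "z \<noteq> a" "z \<noteq> b" "val z < val b"
  shows "val z < val a" "A a z"
proof -
  show "val z < val a"
    using no_point_in_rectangle[of z] assms val_eq[of z a] by (metis linorder_neqE)
  then show "A a z" using assms by (auto simp: exch_arc_def)
qed

lemma not_T': "(k, j) \<notin> T \<Longrightarrow> k < pos a \<or> pos b \<le> k \<or> j \<le> val a \<or> val b < j \<Longrightarrow> (k, j) \<notin> T'"
  using T'_subset by auto

text \<open>
  An arc \<open>x \<rightarrow> y\<close> away from \<open>a\<close> and \<open>b\<close> can only be destroyed by a new obstruction, hence its
  rectangle meets that of \<open>a\<close> and \<open>b\<close>. If it sticks out to the left or right, a column next to the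
  rectangle of \<open>a\<close> and \<open>b\<close> is still free. Otherwise \<open>x\<close> lies below and \<open>y\<close> above that rectangle, so
  \<open>a \<rightarrow> x \<rightarrow> y \<rightarrow> b\<close> contradicts the covering property.
\<close>

lemma arc_preserved:
  assumes "A x y" "x \<notin> {a, b}" "y \<notin> {a, b}"
  shows "P' x y"
proof (cases "A' x y")
  case False
  have xy: "pos x < pos y" using assms by (simp add: exch_arc_def)
  have free: "(k, j) \<notin> T" if "pos x \<le> k" "k < pos y" "val x < j" "j \<le> val y" for k j
    using assms(1) that by (simp add: exch_arc_def)
  obtain k j where kj: "pos x \<le> k" "k < pos y" "val x < j" "j \<le> val y" "(k, j) \<in> T'"
    using False assms xy by (auto simp: exch_arc_def)
  with free not_T' have R: "pos a \<le> k" "k < pos b" "val a < j" "j \<le> val b"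
    by (meson not_le)+
  consider "pos x < pos a" | "pos b < pos y" | "pos a < pos x" "pos y < pos b"
    using assms(2,3) pos_eq[of x a] pos_eq[of y b] by (metis insertCI linorder_neqE)
  then show ?thesis
  proof cases
    case 1
    show ?thesis
    proof (rule column)
      show "pos' x \<le> pos a - 1" "pos a - 1 < pos' y" using assms 1 R kj by auto
      show "(pos a - 1, i) \<notin> T'" if "val x < i" "i \<le> val y" for i
        using that 1 R kj by (intro not_T' free) auto
    qed
  next
    case 2
    show ?thesis
    proof (rule column)
      show "pos' x \<le> pos b" "pos b < pos' y" using assms 2 R kj by auto
      show "(pos b, i) \<notin> T'" if "val x < i" "i \<le> val y" for i
        using that 2 R kj by (intro not_T' free) auto
    qed
  next
    case 3
    have "A a x" using below_rectangle[of x] assms 3 R kj xy by auto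
    moreover have "val b < val y"
      using no_point_in_rectangle[of y] val_eq[of y b] assms 3 R kj xy by fastforce
    then have "A y b" using 3 by (auto simp: exch_arc_def)
    ultimately show ?thesis using assms(1) nothing_between by (meson P_trans tranclp.r_into_trancl)
  qed
qed (rule tranclp.r_into_trancl)

text \<open>
  The column just left of \<open>a\<close> gained no obstruction.
\<close>

lemma arc_to_lower_preserved:
  assumes "A x a"
  shows "P' x a"
proof (rule column)
  have xa: "pos x < pos a" "x \<noteq> a" "x \<noteq> b" using assms pos_ab by (auto simp: exch_arc_def)
  then show "pos' x \<le> pos a - 1" "pos a - 1 < pos' a" using pos_ab by auto
  show "(pos a - 1, j) \<notin> T'" if "val x < j" "j \<le> val a" for j
    using assms xa that by (intro not_T') (auto simp: exch_arc_def)
qed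

lemma arc_to_upper_preserved:
  assumes "A x b" "x \<noteq> a"
  shows "P' x b \<or> P' x a"
proof -
  have x: "pos x < pos b" "x \<noteq> b" using assms by (auto simp: exch_arc_def)
  show ?thesis
  proof (cases "pos x < pos a")
    case True
    have "P' x b"
    proof (rule column)
      show "pos' x \<le> pos a - 1" "pos a - 1 < pos' b" using True assms x by auto
      show "(pos a - 1, j) \<notin> T'" if "val x < j" "j \<le> val b" for j
        using assms True that pos_ab by (intro not_T') (auto simp: exch_arc_def)
    qed
    then show ?thesis ..
  next
    case False
    then have ax: "pos a < pos x" using assms pos_eq[of x a] by (metis linorder_neqE)
    have "\<not> A a x" using assms(1) nothing_between by blast
    then have "val b < val x"
      using below_rectangle(2)[OF ax x(1) assms(2) x(2)] val_eq[of x b] x(2) by (metis linorder_neqE)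
    then have "A' x a" using assms x val_ab by (auto simp: exch_arc_def)
    then show ?thesis by blast
  qed
qed

lemma new_arc_to_upper:
  assumes "A' x b"
  shows "A x a"
proof -
  have x: "x \<noteq> a" "x \<noteq> b" using assms pos_ab by (auto simp: exch_arc_def)
  then show ?thesis using assms val_ab T_subset by (auto simp: exch_arc_def)
qed

text \<open>
  An arc into \<open>a\<close> at its new place comes from an arc into \<open>a\<close> or into \<open>b\<close>. For \<open>x\<close> to the right of the
  old place of \<open>a\<close>, the rectangle of \<open>x\<close> and \<open>b\<close> is free: its part above \<open>a\<close> lies in the rectangle of
  \<open>a\<close> and \<open>b\<close>, and its part below in that of the new arc.
\<close>

lemma new_arc_to_lower:
  assumes "A' x a" "x \<noteq> b"
  shows "A x a \<or> (A x b \<and> pos a < pos x)"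
proof -
  have x: "x \<noteq> a" using assms by (auto simp: exch_arc_def)
  then have "pos x < pos b" using assms by (simp add: exch_arc_def)
  note x = x this
  show ?thesis
  proof (cases "pos x < pos a")
    case True
    then have "A x a" using assms x T_subset pos_ab by (auto simp: exch_arc_def)
    then show ?thesis ..
  next
    case False
    then have ax: "pos a < pos x" using x pos_eq[of x a] by (metis linorder_neqE)
    have "A x b"
      unfolding exch_arc_def
    proof (intro conjI allI impI)
      fix k j
      assume kj: "pos x \<le> k \<and> k < pos b \<and> val x < j \<and> j \<le> val b"
      show "(k, j) \<notin> T"
      proof (cases "val a < j")
        case True
        then show ?thesis using arc_ab kj ax by (auto simp: exch_arc_def)
      next
        case False
        then show ?thesis using assms kj x T_subset by (auto simp: exch_arc_def)
      qed
    qed (use x in simp)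
    then show ?thesis using ax by blast
  qed
qed

text \<open>
  A half turn reverses all arcs and exchanges the roles of \<open>a\<close> and \<open>b\<close>, so each statement about arcs
  into \<open>a\<close> or \<open>b\<close> has a counterpart about arcs out of \<open>b\<close> or \<open>a\<close>.
\<close>

lemma rotated: "up_step (\<lambda>x. - pos x) (\<lambda>x. - val x) (rotate_tight T) (rotate_tight T') b a (\<lambda>x. - pos' x)"
proof
  show "(\<lambda>x. - pos' x) = (\<lambda>x. - pos x) \<circ> Transposition.transpose b a"
    by (auto simp: pos'_def transpose_commute)
  show "inj (\<lambda>x. - pos x)" "inj (\<lambda>x. - val x)" by (simp_all add: inj_def)
  show "- val b < - val a" using val_ab by simp
  show "hasse (exch_arc (\<lambda>x. - pos x) (\<lambda>x. - val x) (rotate_tight T)) b a"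
    using hasse_ab by (simp add: arc_rotate_eq hasse_converse)
  show "rotate_tight T \<subseteq> rotate_tight T'" using T_subset by (auto simp: rotate_tight_def)
  show "rotate_tight T' \<subseteq> rotate_tight T \<union> {- pos b..<- pos a} \<times> {- val b<..- val a}"
  proof
    fix kj assume "kj \<in> rotate_tight T'"
    then obtain k j where "kj = (k, j)" "(- k - 1, 1 - j) \<in> T'" by (auto simp: rotate_tight_def)
    moreover from this have "(- k - 1, 1 - j) \<in> T \<or>
      - k - 1 \<in> {pos a..<pos b} \<and> 1 - j \<in> {val a<..val b}" using T'_subset by blast
    ultimately show "kj \<in> rotate_tight T \<union> {- pos b..<- pos a} \<times> {- val b<..- val a}"
      by (auto simp: rotate_tight_def)
  qed
  fix x y k
  assume k: "- pos' x \<le> k" "k < - pos' y"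
    and free: "\<And>j. - val x < j \<Longrightarrow> j \<le> - val y \<Longrightarrow> (k, j) \<notin> rotate_tight T'"
  have "P' y x"
  proof (rule column)
    show "pos' y \<le> - k - 1" "- k - 1 < pos' x" using k by auto
    show "(- k - 1, j) \<notin> T'" if "val y < j" "j \<le> val x" for j
      using free[of "1 - j"] that by (auto simp: rotate_tight_def)
  qed
  then show "(exch_arc (\<lambda>x. - pos' x) (\<lambda>x. - val x) (rotate_tight T'))\<^sup>+\<^sup>+ x y"
    unfolding arc_rotate_eq tranclp_converse by simp
qed

lemmas rotate_simps = arc_rotate_eq tranclp_converse conversep_iff hasse_converse

lemma new_arc_from_lower: "A' a y \<Longrightarrow> A b y"
  using up_step.new_arc_to_upper[OF rotated, unfolded rotate_simps] .

lemma new_arc_from_upper: "A' b y \<Longrightarrow> y \<noteq> a \<Longrightarrow> A a y \<or> A b y"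
  using up_step.new_arc_to_lower[OF rotated, unfolded rotate_simps] by blast

text \<open>
  Before the exchange \<open>a\<close> precedes \<open>b\<close>, afterwards \<open>b\<close> precedes \<open>a\<close>. A relation out of \<open>b\<close>, or into \<open>a\<close>,
  after the exchange therefore translates to one out of \<open>a\<close>, or into \<open>b\<close>, before.
\<close>

definition source :: "'a \<Rightarrow> 'a" where "source x = (if x = b then a else x)"
definition target :: "'a \<Rightarrow> 'a" where "target x = (if x = a then b else x)"

lemma new_arc:
  assumes "A' x y"
  shows "P (source x) (target y)" "y = b \<Longrightarrow> P (source x) a" "x = a \<Longrightarrow> P b (target y)"
proof -
  have xy: "pos' x < pos' y" using assms by (simp add: exch_arc_def)
  have ab: "P a b" using arc_ab ..
  show 2: "P (source x) a" if "y = b"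
    using new_arc_to_upper[of x] assms that pos_ab by (auto simp: source_def exch_arc_def)
  show 3: "P b (target y)" if "x = a"
    using new_arc_from_lower[of y] assms that pos_ab by (auto simp: target_def exch_arc_def)
  consider "y = b" | "x = a" | "x = b" "y = a" | "x = b" "y \<noteq> a" "y \<noteq> b"
    | "y = a" "x \<noteq> a" "x \<noteq> b" | "x \<notin> {a, b}" "y \<notin> {a, b}" by blast
  then show "P (source x) (target y)"
  proof cases
    case 1
    then show ?thesis using 2 ab P_trans by (auto simp: target_def)
  next
    case 2
    then show ?thesis using 3 ab P_trans by (auto simp: source_def)
  next
    case 3
    then show ?thesis using ab by (simp add: source_def target_def)
  next
    case 4
    then show ?thesis using new_arc_from_upper[of y] assms ab P_trans[of a b y]
      by (auto simp: source_def target_def)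
  next
    case 5
    then show ?thesis using new_arc_to_lower[of x] assms ab P_trans[of x a b]
      by (auto simp: source_def target_def)
  next
    case 6
    then have "A x y" using assms T_subset by (auto simp: exch_arc_def)
    then show ?thesis using 6 by (auto simp: source_def target_def)
  qed
qed

text \<open>
  Every relation after the exchange is one before it, up to replacing the ends \<open>a\<close> and \<open>b\<close>. The two
  stronger clauses, for the ends \<open>b\<close> and \<open>a\<close>, are what makes the induction pass through these two points.
\<close>

lemma new_path:
  assumes "P' x y"
  shows "P (source x) (target y) \<and> (y = b \<longrightarrow> P (source x) a) \<and> (x = a \<longrightarrow> P b (target y))"
  using assms
proof (induction rule: tranclp_induct)
  case (base y)
  then show ?case using new_arc by blast
next
  case (step y z)
  have xy: "pos' x < pos' y" and yz: "pos' y < pos' z"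
    using step.hyps arc_pos[of pos' val T'] by (auto simp: exch_arc_def)
  note new = new_arc[OF step.hyps(2)]
  consider "y = a" | "y = b" | "y \<notin> {a, b}" by blast
  then show ?case
  proof cases
    case 1
    then have "z \<noteq> b" "x \<noteq> a" using xy yz pos_ab by auto
    then show ?thesis using 1 step.IH new(3) P_trans[of "source x" b "target z"] by (simp add: target_def)
  next
    case 2
    then have "z \<noteq> b" "x \<noteq> a" using xy yz pos_ab by auto
    then show ?thesis using 2 step.IH new(1) P_trans[of "source x" a "target z"] by (simp add: source_def)
  next
    case 3
    then have "target y = y" "source y = y" by (auto simp: source_def target_def)
    then show ?thesis using step.IH new P_trans[of _ y] by auto
  qed
qed

lemma hasse_away:
  assumes h: "hasse A c d" and c: "c \<notin> {a, b}" and d: "d \<notin> {a, b}"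
  shows "hasse A' c d"
  unfolding hasse_def
proof (intro conjI notI)
  show "P' c d" using arc_preserved[OF hasse_imp_step[OF h] c d] .
  have none: False if "P c z" "P z d" for z using h that by (auto simp: hasse_def)
  assume "\<exists>z. P' c z \<and> P' z d"
  then obtain z where z: "P' c z" "P' z d" by blast
  have sc: "source c = c" "target d = d" using c d by (auto simp: source_def target_def)
  consider "z = a" | "z = b" | "source z = z" "target z = z" by (metis source_def target_def)
  then show False
  proof cases
    case 1
    then show ?thesis using new_path[OF z(1)] new_path[OF z(2)] none[of b] sc by (simp add: target_def)
  next
    case 2
    then show ?thesis using new_path[OF z(1)] new_path[OF z(2)] none[of a] sc by (simp add: source_def)
  next
    case 3
    then show ?thesis using new_path[OF z(1)] new_path[OF z(2)] none[of z] sc by simp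
  qed
qed

lemma hasse_reversed: "hasse A' b a"
  unfolding hasse_def
proof (intro conjI notI)
  have "A' b a" using pos_ab val_ab by (auto simp: exch_arc_def)
  then show "P' b a" ..
  assume "\<exists>z. P' b z \<and> P' z a"
  then obtain z where z: "P' b z" "P' z a" by blast
  then have "z \<noteq> a" "z \<noteq> b" using arc_pos by fastforce+
  then show False
    using new_path[OF z(1)] new_path[OF z(2)] nothing_between by (simp add: source_def target_def)
qed

lemma path_crosses_column:
  assumes "P' c z" "pos' c < k" "k \<le> pos' z"
  obtains x y where "c = x \<or> P' c x" "A' x y" "y = z \<or> P' y z" "pos' x < k" "k \<le> pos' y"
  using assms
proof (induction arbitrary: thesis rule: tranclp_induct)
  case (base y)
  then show ?case by blast
next
  case (step y z)
  show ?case
  proof (cases "pos' y < k")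
    case True
    then show ?thesis using step.prems step.hyps by blast
  next
    case False
    then obtain x y' where "c = x \<or> P' c x" "A' x y'" "y' = y \<or> P' y' y" "pos' x < k" "k \<le> pos' y'"
      using step.IH step.prems by (metis not_less)
    then show ?thesis using step.prems(1)[of x y'] step.hyps(2)
      by (meson tranclp.r_into_trancl tranclp.trancl_into_trancl)
  qed
qed

text \<open>
  The essential case of \<open>hasse_into\<close>. Let \<open>a\<close> cover \<open>c\<close> before the exchange, let \<open>c\<close> not precede \<open>b\<close>
  afterwards, and suppose that a path leads from \<open>c\<close> to \<open>z\<close> and then to the new place of \<open>a\<close>. As \<open>z\<close> did
  not precede \<open>a\<close>, its point lies between the columns of \<open>a\<close> and \<open>b\<close>, and \<open>z \<rightarrow> b\<close> was an arc. Some arc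
  \<open>x \<rightarrow> y\<close> of the path crosses the column just left of the old place of \<open>a\<close>, which is the new place of \<open>b\<close>.
  If \<open>y\<close> is at least as high as \<open>b\<close>, this column makes \<open>x\<close> precede \<open>b\<close>, which was excluded. If \<open>y\<close> is lower,
  it lies under the rectangle of \<open>a\<close> and \<open>b\<close>, and \<open>a \<rightarrow> y\<close> followed by the path to \<open>z\<close> and the arc
  \<open>z \<rightarrow> b\<close> contradicts the covering property.
\<close>

lemma no_detour_to_lower:
  assumes h: "hasse A c a" and nb: "\<not> P' c b" and z: "P' c z" "A' z a"
  shows False
proof -
  have ca: "pos c < pos a" using hasse_imp_step[OF h] by (simp add: exch_arc_def)
  have c: "c \<notin> {a, b}" using ca pos_ab by auto
  have none: False if "P c z" "P z a" for z using h that by (auto simp: hasse_def)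
  have za: "z \<notin> {a, b}" using z nb by (auto simp: exch_arc_def)
  have cz: "P c z" using new_path[OF z(1)] c za by (auto simp: source_def target_def)
  then have zb: "A z b" and az: "pos a < pos z"
    using new_arc_to_lower[OF z(2)] za none[of z] by auto
  then have zb': "pos z < pos b" by (simp add: exch_arc_def)
  obtain x y where xy: "c = x \<or> P' c x" "A' x y" "y = z \<or> P' y z" "pos' x < pos a" "pos a \<le> pos' y"
    using path_crosses_column[OF z(1), of "pos a"] ca az za c by auto
  have x: "x \<notin> {a, b}" using xy pos_ab by auto
  have yz: "pos' y \<le> pos z" using xy(3) za arc_pos[of pos' val T' y z] by auto
  have "y \<noteq> b" using xy nb by (metis tranclp.r_into_trancl tranclp_trans)
  moreover have "y \<noteq> a" using yz zb' by auto
  ultimately have y: "y \<notin> {a, b}" by auto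
  have xb: "\<not> P' x b" using xy(1) nb by (metis tranclp_trans)
  have "val y < val b"
  proof (rule ccontr)
    assume yb: "\<not> val y < val b"
    have "P' x b"
    proof (rule column)
      show "pos' x \<le> pos a - 1" "pos a - 1 < pos' b" using xy by auto
      show "(pos a - 1, j) \<notin> T'" if "val x < j" "j \<le> val b" for j
        using xy(2,4,5) yb that by (auto simp: exch_arc_def)
    qed
    with xb show False ..
  qed
  moreover have "pos a < pos y" "pos y < pos b"
    using xy(5) y yz zb' pos_eq[of a y] by (auto simp: order.order_iff_strict)
  ultimately have "A a y" using below_rectangle(2)[of y] y by auto
  moreover have "y = z \<or> P y z"
    using xy(3) new_path[of y z] y za by (auto simp: source_def target_def)
  then have "P y b" using zb by (auto intro: tranclp.trancl_into_trancl)
  ultimately show False using nothing_between by blast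
qed

text \<open>
  If \<open>c\<close> precedes \<open>b\<close> after the exchange, then \<open>b\<close> covers it, since anything between would have
  been between \<open>c\<close> and \<open>a\<close> before. Otherwise \<open>a\<close> covers it.
\<close>

lemma hasse_into:
  assumes h: "hasse A c d" and d: "d \<in> {a, b}" and c: "c \<noteq> a"
  shows "hasse A' c a \<or> hasse A' c b"
proof -
  have cd: "pos c < pos d" using hasse_imp_step[OF h] by (simp add: exch_arc_def)
  have c': "c \<notin> {a, b}" using c cd d pos_ab by auto
  have none: False if "P c z" "P z d" for z using h that by (auto simp: hasse_def)
  have sc: "source c = c" using c' by (auto simp: source_def)
  show ?thesis
  proof (cases "P' c b")
    case True
    then have "P c a" using new_path sc by metis
    then have "d = a" using none[of a] arc_ab d by auto
    have False if z: "P' c z" "P' z b" for z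
    proof -
      have "z \<noteq> a" "z \<noteq> b" using arc_pos[OF z(2)] pos_ab by auto
      then have "P c z" "P z a" using new_path[OF z(1)] new_path[OF z(2)] sc
        by (auto simp: source_def target_def)
      then show False using none \<open>d = a\<close> by blast
    qed
    then show ?thesis using True by (auto simp: hasse_def)
  next
    case False
    then have ca: "P' c a"
      using arc_to_lower_preserved[of c] arc_to_upper_preserved[of c] hasse_imp_step[OF h] d c by auto
    have False if z: "P' c z" "P' z a" for z
    proof -
      obtain y where y: "P' c y" "A' y a"
        using z by (metis tranclp.cases tranclp_trans)
      have "y \<noteq> b" using y False by auto
      moreover have "y \<noteq> a" using y(2) by (auto simp: exch_arc_def)
      ultimately have "P c y" "P y b" using new_path[OF y(1)] new_arc(1)[OF y(2)] sc
        by (auto simp: source_def target_def)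
      then have "d = a" using none d by blast
      then show False using no_detour_to_lower[OF _ False y] h by blast
    qed
    then show ?thesis using ca by (auto simp: hasse_def)
  qed
qed

lemma hasse_out_of:
  assumes "hasse A c d" "c \<in> {a, b}" "d \<noteq> b"
  shows "hasse A' a d \<or> hasse A' b d"
  using up_step.hasse_into[OF rotated, unfolded rotate_simps, where c = d and d = c] assms by auto

text \<open>
  The map \<open>source\<close> merges \<open>b\<close> into \<open>a\<close>. Two covering pairs with the same image differ in one end, and
  together with \<open>(a, b)\<close> they would form a triangle, one side of which is not a covering pair.
\<close>

lemma inj_on_merge: "inj_on (map_prod source source) {(x, y). hasse A x y}"
proof (rule inj_onI)
  fix e e' assume e: "e \<in> {(x, y). hasse A x y}" "e' \<in> {(x, y). hasse A x y}"
    and eq': "map_prod source source e = map_prod source source e'"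
  obtain c d c' d' where cd: "e = (c, d)" "e' = (c', d')" by fastforce
  then have h: "hasse A c d" "hasse A c' d'" using e by auto
  have eq: "source c = source c'" "source d = source d'" using eq' cd by auto
  have pos: "pos c < pos d" "pos c' < pos d'"
    using hasse_imp_step h by (auto simp: exch_arc_def dest!: hasse_imp_step)
  have no: False if "hasse A x b" "hasse A x a" for x
    using that arc_ab by (auto simp: hasse_def)
  have no': False if "hasse A a x" "hasse A b x" for x
    using that arc_ab by (auto simp: hasse_def)
  have "c = c' \<and> d = d'"
    using eq h pos no[of c] no[of c'] no'[of d] no'[of d'] pos_ab
    by (auto simp: source_def split: if_splits)
  then show "e = e'" using cd by simp
qed

theorem card_hasse_le:
  assumes "finite {(x, y). hasse A' x y}"
  shows "card {(x, y). hasse A x y} \<le> card {(x, y). hasse A' x y}"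
proof -
  let ?H = "{(x, y). hasse A x y}" and ?H' = "{(x, y). hasse A' x y}"
  have "map_prod source source ` ?H \<subseteq> map_prod source source ` ?H'"
  proof (rule image_subsetI)
    fix e assume "e \<in> ?H"
    then obtain c d where e: "e = (c, d)" and h: "hasse A c d" by auto
    have cd: "pos c < pos d" using hasse_imp_step[OF h] by (simp add: exch_arc_def)
    have "\<exists>c' d'. hasse A' c' d' \<and> source c' = source c \<and> source d' = source d"
    proof (cases "c \<in> {a, b}")
      case True
      show ?thesis
      proof (cases "d = b")
        case d: True
        then have "c = a" using True cd by auto
        then show ?thesis using hasse_reversed d by (intro exI[of _ b] exI[of _ a]) (simp add: source_def)
      next
        case False
        then have "source a = source c" "source b = source c" using True by (auto simp: source_def)
        then show ?thesis using hasse_out_of[OF h True False] by metis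
      qed
    next
      case c: False
      show ?thesis
      proof (cases "d \<in> {a, b}")
        case True
        then have "source a = source d" "source b = source d" by (auto simp: source_def)
        then show ?thesis using hasse_into[OF h True] c by (metis insertCI)
      next
        case False
        then show ?thesis using hasse_away[OF h c False] by blast
      qed
    qed
    then obtain c' d' where "hasse A' c' d'" "source c' = source c" "source d' = source d" by blast
    then have "map_prod source source (c, d) = map_prod source source (c', d')" "(c', d') \<in> ?H'" by auto
    then show "map_prod source source e \<in> map_prod source source ` ?H'"
      unfolding e by (rule image_eqI)
  qed
  then have "card (map_prod source source ` ?H) \<le> card (map_prod source source ` ?H')"
    using assms by (intro card_mono finite_imageI)
  also have "\<dots> \<le> card ?H'" using assms by (rule card_image_le)
  finally show ?thesis by (simp add: card_image[OF inj_on_merge])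
qed

end

section \<open>The exchange order at a permutation\<close>

text \<open>
  Only natural numbers occur here, as a rectangle whose corners are natural numbers
  contains no negative integers.
\<close>

definition tight :: "(nat \<Rightarrow> nat) \<Rightarrow> (nat \<Rightarrow> nat) \<Rightarrow> (int \<times> int) set" where
  "tight u w = {(int k, int j) | k j. rnk u k j = rnk w k j}"

text \<open>
  Points are indexed by their values, and all natural numbers are admitted; \<open>perm_arc_range\<close> shows that
  the fixed points outside \<open>{1..n}\<close> are isolated, so no carrier has to be mentioned.
\<close>

definition perm_arc :: "(nat \<Rightarrow> nat) \<Rightarrow> (nat \<Rightarrow> nat) \<Rightarrow> nat \<Rightarrow> nat \<Rightarrow> bool" where
  "perm_arc u w = exch_arc (\<lambda>x. int (inv u x)) int (tight u w)"

lemma perm_arc_iff: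
  "perm_arc u w x y \<longleftrightarrow> inv u x < inv u y \<and>
     (\<forall>k j. inv u x \<le> k \<and> k < inv u y \<and> x < j \<and> j \<le> y \<longrightarrow> rnk u k j \<noteq> rnk w k j)"
proof -
  have "(\<forall>k j. int (inv u x) \<le> k \<and> k < int (inv u y) \<and> int x < j \<and> j \<le> int y \<longrightarrow> (k, j) \<notin> tight u w)
    \<longleftrightarrow> (\<forall>k j. inv u x \<le> k \<and> k < inv u y \<and> x < j \<and> j \<le> y \<longrightarrow> rnk u k j \<noteq> rnk w k j)"
    (is "?L \<longleftrightarrow> ?R")
  proof
    assume L: ?L
    show ?R
    proof (intro allI impI)
      fix k j assume "inv u x \<le> k \<and> k < inv u y \<and> x < j \<and> j \<le> y"
      then show "rnk u k j \<noteq> rnk w k j" using L[rule_format, of "int k" "int j"] by (auto simp: tight_def)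
    qed
  next
    assume R: ?R
    show ?L
    proof (intro allI impI notI)
      fix k j
      assume kj: "int (inv u x) \<le> k \<and> k < int (inv u y) \<and> int x < j \<and> j \<le> int y" "(k, j) \<in> tight u w"
      then obtain k' j' where "k = int k'" "j = int j'" "rnk u k' j' = rnk w k' j'"
        by (auto simp: tight_def)
      then show False using kj R by auto
    qed
  qed
  then show ?thesis by (simp add: perm_arc_def exch_arc_def)
qed

lemma switch_point:
  fixes P :: "nat \<Rightarrow> bool"
  assumes "lo \<le> k" "k < hi" "lo \<le> k'" "k' < hi" "P k \<noteq> P k'"
  obtains i where "lo \<le> i" "Suc i < hi" "P i \<noteq> P (Suc i)"
proof (rule ccontr)
  note found = that
  assume "\<not> thesis"
  then have step: "P i = P (Suc i)" if "lo \<le> i" "Suc i < hi" for i using found that by blast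
  have "i < hi \<longrightarrow> P i = P lo" if "lo \<le> i" for i
    using that by (induction i rule: dec_induct) (use step in auto)
  then show False using assms by metis
qed

text \<open>
  An exchange of \<open>x\<close> and \<open>y\<close> may be unobstructed in one column \<open>k\<close> and obstructed elsewhere. Then there are
  two neighbouring columns, one free and one obstructed, and the value \<open>z\<close> in which their prefixes differ splits
  the exchange into exchanges of \<open>x\<close> with \<open>z\<close> and of \<open>z\<close> with \<open>y\<close>, each of which is free in one of the two
  columns. These have closer ends, so induction applies. That the smaller exchanges are free follows by
  comparing how \<open>rnk u\<close> and \<open>rnk w\<close> change between the two columns: tightness changes at \<open>j\<close> only
  if exactly one of \<open>z\<close> and \<open>w (Suc i)\<close> is \<open>\<ge> j\<close>.
\<close>

lemma column_path:
  assumes u: "u permutes {1..n}" and dom: "dominated u w"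
  shows "inv u x \<le> k \<Longrightarrow> k < inv u y \<Longrightarrow> (\<And>j. x < j \<Longrightarrow> j \<le> y \<Longrightarrow> rnk u k j \<noteq> rnk w k j)
    \<Longrightarrow> (perm_arc u w)\<^sup>+\<^sup>+ x y"
proof (induction "inv u y - inv u x" arbitrary: x y k rule: less_induct)
  case less
  define free where "free k \<longleftrightarrow> (\<forall>j. x < j \<and> j \<le> y \<longrightarrow> rnk u k j \<noteq> rnk w k j)" for k
  show ?case
  proof (cases "perm_arc u w x y")
    case True
    then show ?thesis ..
  next
    case False
    then obtain k' where k': "inv u x \<le> k'" "k' < inv u y" "\<not> free k'"
      using less.prems by (auto simp: perm_arc_iff free_def)
    moreover have "free k" using less.prems by (auto simp: free_def)
    ultimately obtain i where i: "inv u x \<le> i" "Suc i < inv u y" "free i \<noteq> free (Suc i)"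
      using switch_point[of "inv u x" k "inv u y" k' free] less.prems by metis
    define z where "z = u (Suc i)"
    have inv_z: "inv u z = Suc i" using u unfolding z_def by (simp add: permutes_inverses)
    have zx: "z \<noteq> x" "z \<noteq> y" using inv_z i by auto
    have ru: "rnk u (Suc i) j = rnk u i j + of_bool (j \<le> z)" for j
      by (simp add: rnk_Suc z_def)
    have rw: "rnk w (Suc i) j = rnk w i j + of_bool (j \<le> w (Suc i))" for j
      by (simp add: rnk_Suc)
    have domD: "rnk u k j \<le> rnk w k j" for k j using dom by (rule dominatedD)
    have to_z: "(perm_arc u w)\<^sup>+\<^sup>+ x z" if "\<And>j. x < j \<Longrightarrow> j \<le> z \<Longrightarrow> rnk u i j \<noteq> rnk w i j"
      using less.hyps[of z x i] that i inv_z by simp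
    have from_z: "(perm_arc u w)\<^sup>+\<^sup>+ z y" if "\<And>j. z < j \<Longrightarrow> j \<le> y \<Longrightarrow> rnk u (Suc i) j \<noteq> rnk w (Suc i) j"
      using less.hyps[of y z "Suc i"] that i inv_z by simp
    have "(perm_arc u w)\<^sup>+\<^sup>+ x z \<and> (perm_arc u w)\<^sup>+\<^sup>+ z y"
    proof (cases "free i")
      case False
      then have free: "free (Suc i)" using i by simp
      obtain j where j: "x < j" "j \<le> y" "rnk u i j = rnk w i j" using False by (auto simp: free_def)
      then have "rnk u (Suc i) j \<noteq> rnk w (Suc i) j" using free by (auto simp: free_def)
      then have zj: "z < j" "j \<le> w (Suc i)"
        using j(3) ru[of j] rw[of j] domD[of "Suc i" j] by (auto simp: of_bool_def split: if_splits)
      show ?thesis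
      proof
        show "(perm_arc u w)\<^sup>+\<^sup>+ x z"
        proof (rule to_z)
          fix j' assume j': "x < j'" "j' \<le> z"
          then have "rnk u (Suc i) j' \<noteq> rnk w (Suc i) j'" using free zj j by (auto simp: free_def)
          then show "rnk u i j' \<noteq> rnk w i j'" using ru[of j'] rw[of j'] j' zj by simp
        qed
        show "(perm_arc u w)\<^sup>+\<^sup>+ z y"
        proof (rule from_z)
          fix j' assume j': "z < j'" "j' \<le> y"
          show "rnk u (Suc i) j' \<noteq> rnk w (Suc i) j'"
          proof (cases "x < j'")
            case True
            then show ?thesis using free j' by (auto simp: free_def)
          next
            case False
            then show ?thesis using ru[of j'] rw[of j'] domD[of i j'] j j' zj by simp
          qed
        qed
      qed
    next
      case True
      then obtain j where j: "x < j" "j \<le> y" "rnk u (Suc i) j = rnk w (Suc i) j"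
        using i by (auto simp: free_def)
      then have "rnk u i j \<noteq> rnk w i j" using True by (auto simp: free_def)
      then have zj: "j \<le> z" "w (Suc i) < j"
        using j(3) ru[of j] rw[of j] domD[of i j] by (auto simp: of_bool_def split: if_splits)
      show ?thesis
      proof
        show "(perm_arc u w)\<^sup>+\<^sup>+ x z"
        proof (rule to_z)
          fix j' assume j': "x < j'" "j' \<le> z"
          show "rnk u i j' \<noteq> rnk w i j'"
          proof (cases "j' \<le> y")
            case True
            then show ?thesis using \<open>free i\<close> j' by (auto simp: free_def)
          next
            case False
            then show ?thesis using ru[of j'] rw[of j'] domD[of "Suc i" j'] j j' zj by simp
          qed
        qed
        show "(perm_arc u w)\<^sup>+\<^sup>+ z y"
        proof (rule from_z)
          fix j' assume j': "z < j'" "j' \<le> y"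
          then have "rnk u i j' \<noteq> rnk w i j'" using True zj j by (auto simp: free_def)
          then show "rnk u (Suc i) j' \<noteq> rnk w (Suc i) j'" using ru[of j'] rw[of j'] j' zj by simp
        qed
      qed
    qed
    then show ?thesis by (auto intro: tranclp_trans)
  qed
qed

lemma permutes_le:
  fixes u :: "nat \<Rightarrow> nat"
  assumes u: "u permutes {1..n}" and "i \<le> m" "n \<le> m"
  shows "u i \<le> m"
  using permutes_in_image[OF u, of i] permutes_not_in[OF u, of i] assms(2,3)
  by (cases "i \<in> {1..n}") auto

lemma rnk_eq_0:
  assumes u: "u permutes {1..n}" and le: "k \<le> m" "n \<le> m" "m < j"
  shows "rnk u k j = 0"
proof -
  have "\<not> j \<le> u i" if "i \<le> k" for i using permutes_le[OF u, of i m] le that by simp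
  then show ?thesis by (simp add: rnk_def)
qed

lemma perm_arc_range:
  assumes u: "u permutes {1..n}" and w: "w permutes {1..n}" and xy: "perm_arc u w x y"
  shows "x \<in> {1..n}" "y \<in> {1..n}"
proof -
  have iu: "inv u permutes {1..n}" using u by (rule permutes_inv)
  have pos: "inv u x < inv u y" using xy by (simp add: perm_arc_iff)
  have not: "rnk u k j \<noteq> rnk w k j" if "inv u x \<le> k" "k < inv u y" "x < j" "j \<le> y" for k j
    using xy that by (simp add: perm_arc_iff)
  have inv0: "inv u 0 = 0" using iu by (simp add: permutes_not_in)
  have "y \<noteq> 0" using pos inv0 by (metis not_less0)
  then have x0: "x \<noteq> 0" using not[of 0 1] inv0 pos by auto
  have yn: "y \<le> n"
  proof (rule ccontr)
    assume "\<not> y \<le> n"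
    then have iy: "inv u y = y" using iu by (simp add: permutes_not_in)
    then have "x < y" using pos iu \<open>\<not> y \<le> n\<close> by (metis atLeastAtMost_iff not_le le_trans less_imp_le permutes_not_in)
    moreover have "rnk u (y - 1) y = 0" "rnk w (y - 1) y = 0"
      using rnk_eq_0[OF u, of "y - 1" "y - 1" y] rnk_eq_0[OF w, of "y - 1" "y - 1" y] \<open>\<not> y \<le> n\<close> by auto
    moreover have "inv u x \<le> y - 1" "y - 1 < inv u y" using pos iy by linarith+
    ultimately show False using not[of "y - 1" y] by simp
  qed
  then have "inv u y \<le> n" using permutes_le[OF iu, of y n] by simp
  then have "x \<le> n" using pos permutes_not_in[OF iu, of x] by fastforce
  then show "x \<in> {1..n}" "y \<in> {1..n}" using x0 yn \<open>y \<noteq> 0\<close> by auto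
qed

lemma finite_hasse_perm_arc:
  assumes "u permutes {1..n}" "w permutes {1..n}"
  shows "finite {(x, y). hasse (perm_arc u w) x y}"
proof (rule finite_subset)
  show "{(x, y). hasse (perm_arc u w) x y} \<subseteq> {1..n} \<times> {1..n}"
    using perm_arc_range[OF assms] hasse_imp_step[of "perm_arc u w"] by blast
qed simp

lemma swap_left:
  assumes "u permutes {1..n}"
  shows "swap x y \<circ> u = u \<circ> swap (inv u x) (inv u y)"
proof
  fix i
  have "i = inv u z \<longleftrightarrow> u i = z" for z using permutes_inverses[OF assms] by metis
  then have "swap x y (u i) = u (swap (inv u x) (inv u y) i)"
    using permutes_inverses[OF assms] by (simp add: Transposition.transpose_def)
  then show "(swap x y \<circ> u) i = (u \<circ> swap (inv u x) (inv u y)) i" by simp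
qed

lemma inv_swap_left:
  assumes "u permutes {1..n}"
  shows "inv (swap x y \<circ> u) = inv u \<circ> swap x y"
  using assms by (simp add: o_inv_distrib permutes_bij)

lemma perm_arc_dominated:
  assumes u: "u permutes {1..n}" and w: "w permutes {1..n}" and dom: "dominated u w"
    and xy: "perm_arc u w x y"
  shows "swap x y \<circ> u permutes {1..n}" "dominated (swap x y \<circ> u) w"
proof -
  let ?p = "inv u x" and ?q = "inv u y"
  have range: "x \<in> {1..n}" "y \<in> {1..n}" using perm_arc_range[OF u w xy] by auto
  have iu: "inv u permutes {1..n}" using u by (rule permutes_inv)
  then have pq: "?p \<in> {1..n}" "?q \<in> {1..n}" "?p < ?q"
    using range permutes_in_image[OF iu] xy by (auto simp: perm_arc_iff)
  have ux: "u ?p = x" "u ?q = y" using u by (auto simp: permutes_inverses)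
  show "swap x y \<circ> u permutes {1..n}"
    using u range by (intro permutes_compose permutes_swap_id)
  show "dominated (swap x y \<circ> u) w"
  proof (cases "x < y")
    case True
    have "rnk (u \<circ> swap ?p ?q) k j \<le> rnk w k j" for k j
      using rnk_swap[of ?p ?q u k j] True pq ux xy dominatedD[OF dom, of k j]
      by (fastforce simp: perm_arc_iff of_bool_def)
    then show ?thesis by (simp add: dominated_def swap_left[OF u])
  next
    case False
    let ?v = "u \<circ> swap ?p ?q"
    have "y < x" using False pq by (cases "x = y") auto
    then have "dominated ?v (?v \<circ> swap ?p ?q)"
      using pq ux by (intro dominated_swap) auto
    then have "dominated ?v u" by (simp add: comp_assoc)
    then show ?thesis unfolding swap_left[OF u] using dom by (rule dominated_trans)
  qed
qed

text \<open>
  The ranks of \<open>u\<close> and of the exchanged permutation agree off the rectangle of \<open>a\<close> and \<open>b\<close>, which contains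
  no tight pair of \<open>u\<close>; this is the situation of the locale \<open>up_step\<close>.
\<close>

theorem card_hasse_perm_arc_mono:
  assumes u: "u permutes {1..n}" and w: "w permutes {1..n}" and dom: "dominated u w"
    and ab: "hasse (perm_arc u w) a b" "a < b"
  shows "card {(x, y). hasse (perm_arc u w) x y} \<le> card {(x, y). hasse (perm_arc (swap a b \<circ> u) w) x y}"
proof -
  let ?v = "swap a b \<circ> u"
  have exch_arc: "perm_arc u w a b" using ab(1) by (rule hasse_imp_step)
  note v = perm_arc_dominated[OF u w dom exch_arc]
  have inv_v: "inv ?v = inv u \<circ> swap a b" by (rule inv_swap_left[OF u])
  have range: "a \<in> {1..n}" using perm_arc_range[OF u w exch_arc] by auto
  have iu: "inv u permutes {1..n}" using u by (rule permutes_inv)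
  have p: "1 \<le> inv u a" "inv u a < inv u b" "u (inv u a) = a" "u (inv u b) = b"
    using range permutes_in_image[OF iu] u exch_arc by (auto simp: perm_arc_iff permutes_inverses)
  have rnk_v: "rnk ?v k j = rnk u k j + of_bool (inv u a \<le> k \<and> k < inv u b \<and> a < j \<and> j \<le> b)" for k j
    unfolding swap_left[OF u] using rnk_swap[of "inv u a" "inv u b" u k j] p ab(2) by simp
  have free: "rnk u k j \<noteq> rnk w k j" if "inv u a \<le> k" "k < inv u b" "a < j" "j \<le> b" for k j
    using exch_arc that by (simp add: perm_arc_iff)
  have pos': "(\<lambda>x. int (inv u x)) \<circ> swap a b = (\<lambda>x. int (inv ?v x))"
    by (auto simp: inv_v)
  interpret up_step "\<lambda>x. int (inv u x)" int "tight u w" "tight ?v w" a b "\<lambda>x. int (inv ?v x)"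
  proof
    show "(\<lambda>x. int (inv ?v x)) = (\<lambda>x. int (inv u x)) \<circ> swap a b" by (simp only: pos')
    show "inj (\<lambda>x. int (inv u x))" using permutes_inj[OF iu] by (simp add: inj_def)
    show "inj int" by simp
    show "int a < int b" using ab(2) by simp
    show "hasse (exch_arc (\<lambda>x. int (inv u x)) int (tight u w)) a b" using ab(1) by (simp add: perm_arc_def)
    show "tight u w \<subseteq> tight ?v w"
    proof
      fix e assume "e \<in> tight u w"
      then obtain k j where e: "e = (int k, int j)" "rnk u k j = rnk w k j" by (auto simp: tight_def)
      then have "rnk ?v k j = rnk w k j" using rnk_v[of k j] free[of k j] by auto
      then show "e \<in> tight ?v w" using e by (auto simp: tight_def)
    qed
    show "tight ?v w \<subseteq> tight u w \<union> {int (inv u a)..<int (inv u b)} \<times> {int a<..int b}"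
    proof
      fix e assume "e \<in> tight ?v w"
      then obtain k j where e: "e = (int k, int j)" "rnk ?v k j = rnk w k j" by (auto simp: tight_def)
      then show "e \<in> tight u w \<union> {int (inv u a)..<int (inv u b)} \<times> {int a<..int b}"
        using rnk_v[of k j] by (auto simp: tight_def of_bool_def split: if_splits)
    qed
    fix x y k
    assume k: "int (inv ?v x) \<le> k" "k < int (inv ?v y)"
      and col: "\<And>j. int x < j \<Longrightarrow> j \<le> int y \<Longrightarrow> (k, j) \<notin> tight ?v w"
    obtain k' where k': "k = int k'" using k(1) by (metis nonneg_int_cases of_nat_0_le_iff order_trans)
    have "(perm_arc ?v w)\<^sup>+\<^sup>+ x y"
    proof (rule column_path[OF v])
      show "inv ?v x \<le> k'" "k' < inv ?v y" using k unfolding k' by auto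
      show "rnk ?v k' j \<noteq> rnk w k' j" if "x < j" "j \<le> y" for j
        using col[of "int j"] that k' by (auto simp: tight_def)
    qed
    then show "(exch_arc (\<lambda>x. int (inv ?v x)) int (tight ?v w))\<^sup>+\<^sup>+ x y" by (simp add: perm_arc_def)
  qed
  show ?thesis
    using card_hasse_le finite_hasse_perm_arc[OF v(1) w] by (simp add: perm_arc_def)
qed

section \<open>Linear functionals on the Bruhat interval\<close>

text \<open>
  Pair off the largest values of \<open>F\<close> on both sides, then the next largest, and so on.
\<close>

lemma sum_le_by_thresholds:
  fixes F :: "'a \<Rightarrow> real"
  assumes "finite A" "finite B" "card A = card B"
    and "\<And>t. card {y \<in> B. t \<le> F y} \<le> card {x \<in> A. t \<le> F x}"
  shows "sum F B \<le> sum F A"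
  using assms
proof (induction "card A" arbitrary: A B)
  case 0
  then show ?case by simp
next
  case (Suc m)
  have ne: "A \<noteq> {}" "B \<noteq> {}" using Suc by auto
  have ex_max: "\<exists>x\<in>C. \<forall>x'\<in>C. F x' \<le> F x" if "finite C" "C \<noteq> {}" for C
    using Max_in[of "F ` C"] Max_ge[of "F ` C"] that by fastforce
  obtain x where x: "x \<in> A" "\<And>x'. x' \<in> A \<Longrightarrow> F x' \<le> F x"
    using ex_max[of A] ne Suc.prems by blast
  obtain y where y: "y \<in> B" "\<And>y'. y' \<in> B \<Longrightarrow> F y' \<le> F y"
    using ex_max[of B] ne Suc.prems by blast
  have "0 < card {y' \<in> B. F y \<le> F y'}" using y Suc.prems by (auto simp: card_gt_0_iff)
  also have "\<dots> \<le> card {x \<in> A. F y \<le> F x}" by (rule Suc.prems)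
  finally have "{x \<in> A. F y \<le> F x} \<noteq> {}" by (metis card.empty less_irrefl)
  then have Fyx: "F y \<le> F x" using x(2) order_trans by blast
  have "sum F (B - {y}) \<le> sum F (A - {x})"
  proof (rule Suc.hyps(1))
    show "m = card (A - {x})" "finite (A - {x})" "finite (B - {y})" "card (A - {x}) = card (B - {y})"
      using Suc x y by auto
    fix t
    show "card {y' \<in> B - {y}. t \<le> F y'} \<le> card {x' \<in> A - {x}. t \<le> F x'}"
    proof (cases "t \<le> F y")
      case True
      have "{y' \<in> B - {y}. t \<le> F y'} = {y' \<in> B. t \<le> F y'} - {y}"
        "{x' \<in> A - {x}. t \<le> F x'} = {x' \<in> A. t \<le> F x'} - {x}" by auto
      then show ?thesis
        using Suc.prems(1,2) Suc.prems(4)[of t] x y True Fyx by (simp add: diff_le_mono)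
    next
      case False
      then have "{y' \<in> B - {y}. t \<le> F y'} = {}" using y by fastforce
      then show ?thesis by (metis card.empty le0)
    qed
  qed
  then show ?case using Fyx x y Suc.prems by (simp add: sum_diff1)
qed

lemma rnk_eq_card:
  assumes "u permutes {1..n}"
  shows "rnk u k j = card {x \<in> u ` {1..k}. j \<le> x}"
proof -
  have "{x \<in> u ` {1..k}. j \<le> x} = u ` {i \<in> {1..k}. j \<le> u i}" by auto
  then have "card {x \<in> u ` {1..k}. j \<le> x} = card {i \<in> {1..k}. j \<le> u i}"
    using card_image inj_on_subset[OF permutes_inj[OF assms] subset_UNIV] by metis
  then show ?thesis by (simp add: rnk_def Int_def)
qed

text \<open>
  Let \<open>m\<close> be the largest value among the first \<open>k\<close> of \<open>u\<close> with \<open>F m < t\<close>, and \<open>J\<close> the first tight row above \<open>m\<close>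
  in column \<open>k\<close>. Every \<open>y < J\<close> standing after position \<open>k\<close> can be exchanged with \<open>m\<close> in this column, hence
  \<open>F y \<le> F m < t\<close>. So below \<open>J\<close> the prefix of \<open>v\<close> reaches the threshold only at values that the prefix of \<open>u\<close>
  contains too. From \<open>J\<close> upwards the prefix of \<open>u\<close> has the maximal number of values allowed by \<open>w\<close>, all
  of which reach the threshold.
\<close>

lemma prefix_thresholds:
  fixes F :: "nat \<Rightarrow> real"
  assumes u: "u permutes {1..n}" and v: "v permutes {1..n}" and w: "w permutes {1..n}"
    and dom: "dominated u w" and dom': "dominated v w" and k: "k \<le> n"
    and F: "\<And>x y. perm_arc u w x y \<Longrightarrow> F y \<le> F x"
  shows "card {y \<in> v ` {1..k}. t \<le> F y} \<le> card {x \<in> u ` {1..k}. t \<le> F x}"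
proof (cases "\<exists>x\<in>u ` {1..k}. F x < t")
  case False
  have "card {y \<in> v ` {1..k}. t \<le> F y} \<le> card (v ` {1..k})" by (intro card_mono) auto
  also have "\<dots> = card (u ` {1..k})"
    using permutes_inj[OF u] permutes_inj[OF v] by (metis card_image inj_on_subset subset_UNIV)
  also have "u ` {1..k} = {x \<in> u ` {1..k}. t \<le> F x}" using False by (auto simp: not_less)
  finally show ?thesis .
next
  case True
  define m where "m = Max {x \<in> u ` {1..k}. F x < t}"
  have "m \<in> {x \<in> u ` {1..k}. F x < t}" unfolding m_def using True by (intro Max_in) auto
  then have m: "m \<in> u ` {1..k}" "F m < t" by auto
  have m_max: "x \<le> m" if "x \<in> u ` {1..k}" "F x < t" for x
    unfolding m_def using that by (intro Max_ge) auto
  define good where "good j \<longleftrightarrow> m < j \<and> rnk u k j = rnk w k j" for j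
  \<comment> \<open>The row \<open>n + 1\<close> is always tight, with both ranks zero, so \<open>J\<close> exists.\<close>
  obtain i where "m = u i" "i \<le> n" using m(1) k by fastforce
  then have "m \<le> n" using permutes_le[OF u, of i n] by simp
  then have "good (Suc n)"
    using rnk_eq_0[OF u k, of "Suc n"] rnk_eq_0[OF w k, of "Suc n"] by (simp add: good_def)
  define J where "J = (LEAST j. good j)"
  have J: "m < J" "rnk u k J = rnk w k J"
    using LeastI[of good, OF \<open>good (Suc n)\<close>] unfolding J_def[symmetric] by (auto simp: good_def)
  have not_good: "\<not> good j" if "j < J" for j using not_less_Least that unfolding J_def by blast
  have below: "y \<in> u ` {1..k}" if y: "y \<in> v ` {1..k}" "t \<le> F y" "y < J" for y
  proof (rule ccontr)
    assume ny: "y \<notin> u ` {1..k}"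
    have "y \<in> {1..n}" using y(1) k permutes_in_image[OF v] by fastforce
    then have "inv u y \<in> {1..n}" using permutes_in_image[OF permutes_inv[OF u]] by blast
    moreover have "inv u y \<notin> {1..k}" using ny permutes_inverses(1)[OF u, of y] by (metis imageI)
    ultimately have "k < inv u y" by auto
    moreover have "inv u m \<le> k" using m(1) permutes_inverses(2)[OF u] by auto
    moreover have "rnk u k j \<noteq> rnk w k j" if "m < j" "j \<le> y" for j
      using not_good[of j] that y(3) by (auto simp: good_def)
    ultimately have "(perm_arc u w)\<^sup>+\<^sup>+ m y" using column_path[OF u dom] by blast
    then have "F y \<le> F m"
    proof (induction rule: tranclp_induct)
      case (step y z)
      then show ?case using F[of y z] by simp
    qed (rule F)
    then show False using y(2) m(2) by simp
  qed
  have above: "t \<le> F x" if "x \<in> u ` {1..k}" "J \<le> x" for x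
    by (rule ccontr) (use m_max[of x] that J(1) in auto)
  have "{y \<in> v ` {1..k}. t \<le> F y} \<subseteq> {x \<in> u ` {1..k}. t \<le> F x \<and> x < J} \<union> {y \<in> v ` {1..k}. J \<le> y}"
    using below by (auto simp: not_less)
  then have "card {y \<in> v ` {1..k}. t \<le> F y} \<le>
    card ({x \<in> u ` {1..k}. t \<le> F x \<and> x < J} \<union> {y \<in> v ` {1..k}. J \<le> y})"
    by (intro card_mono) auto
  also have "\<dots> \<le> card {x \<in> u ` {1..k}. t \<le> F x \<and> x < J} + card {y \<in> v ` {1..k}. J \<le> y}"
    by (rule card_Un_le)
  also have "card {y \<in> v ` {1..k}. J \<le> y} \<le> card {x \<in> u ` {1..k}. J \<le> x}"
    using dominatedD[OF dom', of k J] J(2)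
    unfolding rnk_eq_card[OF u, symmetric] rnk_eq_card[OF v, symmetric] by simp
  also have "card {x \<in> u ` {1..k}. t \<le> F x \<and> x < J} + card {x \<in> u ` {1..k}. J \<le> x} =
    card ({x \<in> u ` {1..k}. t \<le> F x \<and> x < J} \<union> {x \<in> u ` {1..k}. J \<le> x})"
    by (intro card_Un_disjoint[symmetric]) auto
  also have "{x \<in> u ` {1..k}. t \<le> F x \<and> x < J} \<union> {x \<in> u ` {1..k}. J \<le> x} = {x \<in> u ` {1..k}. t \<le> F x}"
    using above by auto
  finally show ?thesis by simp
qed

text \<open>
  Abel summation: the position of \<open>x\<close> is the number of proper prefixes that do not contain \<open>x\<close>, the empty
  one included.
\<close>

lemma weight_by_prefixes:
  fixes F :: "nat \<Rightarrow> real"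
  assumes u: "u permutes {1..n}"
  shows "(\<Sum>x\<in>{1..n}. F x * real (inv u x)) = real n * sum F {1..n} - (\<Sum>k<n. sum F (u ` {1..k}))"
proof -
  have iu: "inv u permutes {1..n}" using u by (rule permutes_inv)
  have prefix: "sum F (u ` {1..k}) = (\<Sum>x\<in>{1..n}. F x * of_bool (inv u x \<le> k))" if "k < n" for k
  proof -
    have "u ` {1..k} = {x \<in> {1..n}. inv u x \<le> k}"
    proof (intro set_eqI iffI)
      fix x assume "x \<in> u ` {1..k}"
      then show "x \<in> {x \<in> {1..n}. inv u x \<le> k}"
        using that permutes_in_image[OF u] permutes_inverses(2)[OF u] by fastforce
    next
      fix x assume x: "x \<in> {x \<in> {1..n}. inv u x \<le> k}"
      then have "inv u x \<in> {1..k}" using permutes_in_image[OF iu, of x] by auto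
      then show "x \<in> u ` {1..k}" using permutes_inverses(1)[OF u, of x] by (metis imageI)
    qed
    then have "sum F (u ` {1..k}) = (\<Sum>x\<in>{1..n}. if inv u x \<le> k then F x else 0)"
      by (simp only: sum.inter_filter finite_atLeastAtMost)
    also have "\<dots> = (\<Sum>x\<in>{1..n}. F x * of_bool (inv u x \<le> k))" by (intro sum.cong) auto
    finally show ?thesis .
  qed
  have count: "(\<Sum>k<n. of_bool (inv u x \<le> k)) = real n - real (inv u x)" if "x \<in> {1..n}" for x
  proof -
    have "inv u x \<le> n" using that permutes_in_image[OF iu, of x] by auto
    moreover have "{..<n} \<inter> {k. inv u x \<le> k} = {inv u x..<n}" by auto
    ultimately show ?thesis by simp
  qed
  have "(\<Sum>k<n. sum F (u ` {1..k})) = (\<Sum>k<n. \<Sum>x\<in>{1..n}. F x * of_bool (inv u x \<le> k))"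
    by (intro sum.cong refl prefix) simp
  also have "\<dots> = (\<Sum>x\<in>{1..n}. \<Sum>k<n. F x * of_bool (inv u x \<le> k))" by (rule sum.swap)
  also have "\<dots> = (\<Sum>x\<in>{1..n}. F x * (real n - real (inv u x)))"
    using count by (intro sum.cong refl) (simp only: sum_distrib_left[symmetric])
  also have "\<dots> = real n * sum F {1..n} - (\<Sum>x\<in>{1..n}. F x * real (inv u x))"
    by (simp add: right_diff_distrib sum_subtractf sum_distrib_left mult.commute)
  finally show ?thesis by simp
qed

text \<open>
  Among the permutations below \<open>w\<close>, every prefix of \<open>u\<close> carries the largest possible weight.
\<close>

lemma weight_minimal:
  fixes F :: "nat \<Rightarrow> real"
  assumes u: "u permutes {1..n}" and v: "v permutes {1..n}" and w: "w permutes {1..n}"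
    and dom: "dominated u w" and dom': "dominated v w"
    and F: "\<And>x y. perm_arc u w x y \<Longrightarrow> F y \<le> F x"
  shows "(\<Sum>x\<in>{1..n}. F x * real (inv u x)) \<le> (\<Sum>x\<in>{1..n}. F x * real (inv v x))"
proof -
  have "sum F (v ` {1..k}) \<le> sum F (u ` {1..k})" if "k < n" for k
  proof (rule sum_le_by_thresholds)
    show "card (u ` {1..k}) = card (v ` {1..k})"
      using permutes_inj[OF u] permutes_inj[OF v] by (metis card_image inj_on_subset subset_UNIV)
    show "card {y \<in> v ` {1..k}. t \<le> F y} \<le> card {x \<in> u ` {1..k}. t \<le> F x}" for t
      using that by (intro prefix_thresholds[OF u v w dom dom' _ F]) auto
  qed auto
  then have "(\<Sum>k<n. sum F (v ` {1..k})) \<le> (\<Sum>k<n. sum F (u ` {1..k}))" by (intro sum_mono) auto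
  then show ?thesis by (simp only: weight_by_prefixes[OF u] weight_by_prefixes[OF v])
qed

text \<open>
  If the arcs at \<open>m\<close> are strict for \<open>F\<close>, the coefficient \<open>F m\<close> can be moved a little in both directions without
  losing minimality at \<open>u\<close>. Every other minimal point must then have the same coordinate \<open>m\<close>.
\<close>

lemma weight_minimal_coordinate:
  fixes F :: "nat \<Rightarrow> real"
  assumes u: "u permutes {1..n}" and v: "v permutes {1..n}" and w: "w permutes {1..n}"
    and dom: "dominated u w" and dom': "dominated v w"
    and F: "\<And>x y. perm_arc u w x y \<Longrightarrow> F y \<le> F x"
    and strict: "\<And>x y. perm_arc u w x y \<Longrightarrow> x = m \<or> y = m \<Longrightarrow> F y < F x"
    and eq: "(\<Sum>x\<in>{1..n}. F x * real (inv u x)) = (\<Sum>x\<in>{1..n}. F x * real (inv v x))"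
  shows "inv v m = inv u m"
proof (cases "m \<in> {1..n}")
  case False
  then show ?thesis using permutes_inv[OF u] permutes_inv[OF v] by (simp add: permutes_not_in)
next
  case True
  let ?E = "{(x, y). perm_arc u w x y \<and> (x = m \<or> y = m)}"
  have "finite ?E"
    by (rule finite_subset[of _ "{1..n} \<times> {1..n}"]) (use perm_arc_range[OF u w] in auto)
  then have fin: "finite ((\<lambda>(x, y). F x - F y) ` ?E)" by simp
  obtain e where e: "e > 0" "\<And>x y. perm_arc u w x y \<Longrightarrow> x = m \<or> y = m \<Longrightarrow> e \<le> F x - F y"
  proof
    define e where "e = Min (insert 1 ((\<lambda>(x, y). F x - F y) ` ?E))"
    show "e > 0" unfolding e_def using fin strict by (subst Min_gr_iff) auto
    show "e \<le> F x - F y" if "perm_arc u w x y" "x = m \<or> y = m" for x y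
      unfolding e_def using fin that by (intro Min_le) auto
  qed
  have perturb: "d * real (inv u m) \<le> d * real (inv v m)" if "\<bar>d\<bar> \<le> e" for d
  proof -
    have anti: "(F(m := F m + d)) y \<le> (F(m := F m + d)) x" if xy: "perm_arc u w x y" for x y
    proof -
      have "x \<noteq> y" using xy by (auto simp: perm_arc_iff)
      then show ?thesis using F[OF xy] e(2)[OF xy] \<open>\<bar>d\<bar> \<le> e\<close> by (auto simp: fun_upd_def)
    qed
    have sum: "(\<Sum>x\<in>{1..n}. (F(m := F m + d)) x * g x) = (\<Sum>x\<in>{1..n}. F x * g x) + d * g m"
      for g :: "nat \<Rightarrow> real"
    proof -
      have "(\<Sum>x\<in>{1..n}. (F(m := F m + d)) x * g x) =
        (\<Sum>x\<in>{1..n}. F x * g x + (if x = m then d * g m else 0))"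
        by (intro sum.cong refl) (auto simp: algebra_simps)
      then show ?thesis using True by (simp add: sum.distrib)
    qed
    show ?thesis using weight_minimal[where F = "F(m := F m + d)", OF u v w dom dom' anti] unfolding sum eq by simp
  qed
  show ?thesis using perturb[of e] perturb[of "- e"] e(1) by simp
qed

section \<open>Edges of the Bruhat interval polytope\<close>

lemma bij_betw_coord_num:
  "bij_betw (coord_num :: 'n::{finite,linorder} \<Rightarrow> nat) UNIV {1..CARD('n)}"
proof -
  have less: "coord_num i < coord_num j" if "i < j" for i j :: 'n
    unfolding coord_num_def
  proof (rule psubset_card_mono)
    show "{..i} \<subset> {..j}" using that by (simp add: atMost_subset_iff less_le psubset_eq)
  qed simp
  have inj: "inj (coord_num :: 'n \<Rightarrow> nat)"
    using less by (intro injI) (metis less_irrefl linorder_neqE)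
  moreover have "range (coord_num :: 'n \<Rightarrow> nat) = {1..CARD('n)}"
  proof (rule card_subset_eq)
    show "range (coord_num :: 'n \<Rightarrow> nat) \<subseteq> {1..CARD('n)}"
    proof
      fix k assume "k \<in> range (coord_num :: 'n \<Rightarrow> nat)"
      then obtain i :: 'n where "k = card {..i}" by (auto simp: coord_num_def)
      moreover have "0 < card {..i}" by (subst card_gt_0_iff) auto
      moreover have "card {..i} \<le> CARD('n)" by (intro card_mono) auto
      ultimately show "k \<in> {1..CARD('n)}" by simp
    qed
    show "card (range (coord_num :: 'n \<Rightarrow> nat)) = card {1..CARD('n)}"
      using inj by (simp add: card_image)
  qed simp
  ultimately show ?thesis by (simp add: bij_betw_def)
qed

lemma inner_perm_point:
  "(\<chi> i. F (coord_num i)) \<bullet> (perm_point u :: real ^ 'n::{finite,linorder}) =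
    (\<Sum>x\<in>{1..CARD('n)}. F x * real (inv u x))"
  using sum.reindex_bij_betw[OF bij_betw_coord_num, of "\<lambda>x. F x * real (inv u x)"]
  by (simp add: inner_vec_def perm_point_def)

text \<open>
  Linear functionals are indexed by coordinates and weights by values; this translates back.
\<close>

lemma every_functional:
  obtains F where "c = (\<chi> i. F (coord_num (i :: 'n::{finite,linorder})))"
proof
  have "inj (coord_num :: 'n \<Rightarrow> nat)" using bij_betw_coord_num[where 'n = 'n] by (simp add: bij_betw_def)
  then show "c = (\<chi> i. (\<lambda>x. c $ inv coord_num x) (coord_num i))"
    by (simp add: vec_eq_iff inv_f_f)
qed

lemma permutation_from_inverse:
  assumes "u permutes A" "v permutes A" "\<And>x. inv u x = inv v x"
  shows "u = v"
proof -
  have "inv u = inv v" using assms(3) by (rule ext)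
  then show ?thesis using permutes_inv_inv[OF assms(1)] permutes_inv_inv[OF assms(2)] by metis
qed

lemma perm_point_nth:
  assumes "x \<in> {1..CARD('n::{finite,linorder})}"
  obtains i where "x = coord_num i" "\<And>u. (perm_point u :: real ^ 'n::{finite,linorder}) $ i = real (inv u x)"
proof -
  have "x \<in> range (coord_num :: 'n \<Rightarrow> nat)" using bij_betw_coord_num[where 'n = 'n] assms by (simp add: bij_betw_def)
  then show thesis using that by (auto simp: perm_point_def)
qed

lemma perm_point_eq:
  assumes "u permutes {1..CARD('n::{finite,linorder})}" "v permutes {1..CARD('n)}"
    and eq: "(perm_point u :: real ^ 'n::{finite,linorder}) = perm_point v"
  shows "u = v"
proof (rule permutation_from_inverse[OF assms(1,2)])
  fix x
  show "inv u x = inv v x"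
  proof (cases "x \<in> {1..CARD('n)}")
    case True
    then obtain i where i: "\<And>u. (perm_point u :: real ^ 'n::{finite,linorder}) $ i = real (inv u x)"
      using perm_point_nth[where 'n = 'n] by metis
    show ?thesis using i[of u] i[of v] eq by simp
  next
    case False
    then show ?thesis using permutes_inv[OF assms(1)] permutes_inv[OF assms(2)] by (simp add: permutes_not_in)
  qed
qed

text \<open>
  The positions of \<open>x\<close> and \<open>y\<close> are the only ones left to distribute.
\<close>

lemma agree_off_pair:
  assumes u: "u permutes A" and v: "v permutes A" and xy: "x \<in> A" "y \<in> A" "x \<noteq> y"
    and agree: "\<And>m. m \<noteq> x \<Longrightarrow> m \<noteq> y \<Longrightarrow> inv v m = inv u m"
  shows "v = u \<or> v = swap x y \<circ> u"
proof -
  have inj_u: "inv u i = inv u j \<longleftrightarrow> i = j" for i j using permutes_inj[OF permutes_inv[OF u]] by (metis injD)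
  have inj_v: "inv v i = inv v j \<longleftrightarrow> i = j" for i j using permutes_inj[OF permutes_inv[OF v]] by (metis injD)
  have pair: "inv v z \<in> {inv u x, inv u y}" if z: "z \<in> {x, y}" for z
  proof (rule ccontr)
    assume no: "inv v z \<notin> {inv u x, inv u y}"
    define m where "m = u (inv v z)"
    have m: "inv u m = inv v z" using permutes_inverses(2)[OF u] by (simp add: m_def)
    then have "m \<noteq> x" "m \<noteq> y" using no by auto
    then have "inv v m = inv v z" using agree m by simp
    then show False using inj_v z \<open>m \<noteq> x\<close> \<open>m \<noteq> y\<close> by auto
  qed
  have perm: "swap x y \<circ> u permutes A" using u xy by (intro permutes_compose permutes_swap_id)
  have inv: "inv (swap x y \<circ> u) = inv u \<circ> swap x y"
    using u by (simp add: o_inv_distrib permutes_bij)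
  have "inv v x \<noteq> inv v y" using inj_v xy by simp
  then consider "inv v x = inv u x" "inv v y = inv u y" | "inv v x = inv u y" "inv v y = inv u x"
    using pair[of x] pair[of y] by auto
  then show ?thesis
  proof cases
    case 1
    then have "inv v z = inv u z" for z using agree by metis
    then show ?thesis using permutation_from_inverse[OF v u] by blast
  next
    case 2
    then have "inv v z = inv (swap x y \<circ> u) z" for z
      unfolding inv using agree by (simp add: Transposition.transpose_def)
    then show ?thesis using permutation_from_inverse[OF v perm] by blast
  qed
qed

lemma weight_swap:
  fixes F :: "nat \<Rightarrow> real"
  assumes u: "u permutes {1..n}" and xy: "x \<in> {1..n}" "y \<in> {1..n}" "x \<noteq> y"
  shows "(\<Sum>z\<in>{1..n}. F z * real (inv (swap x y \<circ> u) z)) =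
    (\<Sum>z\<in>{1..n}. F z * real (inv u z)) + (F x - F y) * (real (inv u y) - real (inv u x))"
proof -
  have split: "sum g {1..n} = g x + g y + sum g ({1..n} - {x, y})" for g :: "nat \<Rightarrow> real"
  proof -
    have "sum g {1..n} = sum g {x, y} + sum g ({1..n} - {x, y})"
      using xy by (intro sum.subset_diff[of "{x, y}", THEN trans[OF _ add.commute]]) auto
    then show ?thesis using xy(3) by simp
  qed
  have "(\<Sum>z\<in>{1..n} - {x, y}. F z * real (inv (swap x y \<circ> u) z)) =
    (\<Sum>z\<in>{1..n} - {x, y}. F z * real (inv u z))"
    unfolding inv_swap_left[OF u] by (intro sum.cong) auto
  then show ?thesis
    unfolding split[of "\<lambda>z. F z * real (inv (swap x y \<circ> u) z)"] split[of "\<lambda>z. F z * real (inv u z)"]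
    by (simp add: inv_swap_left[OF u] algebra_simps)
qed

text \<open>
  The vertex of \<open>u\<close> in the polytope of \<open>w\<close>. The type argument fixes the ambient space.
\<close>

locale bruhat_vertex =
  fixes N :: "'n::{finite,linorder} itself" and u w :: "nat \<Rightarrow> nat"
  assumes u: "u permutes {1..CARD('n)}" and w: "w permutes {1..CARD('n)}"
    and dom: "dominated u w"
begin

abbreviation pt :: "(nat \<Rightarrow> nat) \<Rightarrow> real ^ 'n::{finite,linorder}" where "pt \<equiv> perm_point"
abbreviation Q :: "(real ^ 'n::{finite,linorder}) set" where "Q \<equiv> bruhat_polytope w"
abbreviation A where "A \<equiv> perm_arc u w"
abbreviation neighbour where "neighbour a b \<equiv> swap a b \<circ> u"

lemma mem_interval: "v \<in> lower_interval CARD('n) w \<longleftrightarrow> v permutes {1..CARD('n)} \<and> dominated v w"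
  by (simp add: lower_interval_eq[OF w])

lemma finite_interval: "finite (lower_interval CARD('n) w)"
  by (rule finite_subset[OF _ finite_permutations[of "{1..CARD('n)}"]]) (auto simp: mem_interval)

lemma pt_in_Q: "v \<in> lower_interval CARD('n) w \<Longrightarrow> pt v \<in> Q"
  by (simp add: bruhat_polytope_def hull_inc)

lemma vertex_in_interval: "u \<in> lower_interval CARD('n) w"
  using u dom by (simp add: mem_interval)

lemma arc_facts:
  assumes "A x y"
  shows "x \<in> {1..CARD('n)}" "y \<in> {1..CARD('n)}" "x \<noteq> y" "inv u x < inv u y" "neighbour x y \<in> lower_interval CARD('n) w"
  using perm_arc_range[OF u w assms] perm_arc_dominated[OF u w dom assms] assms
  by (auto simp: mem_interval perm_arc_iff)

lemma path_pos: "A\<^sup>+\<^sup>+ x y \<Longrightarrow> inv u x < inv u y"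
  by (induction rule: tranclp_induct) (auto simp: perm_arc_iff)

lemma pt_neighbour_neq: "A x y \<Longrightarrow> pt (neighbour x y) \<noteq> pt u"
proof
  assume xy: "A x y" and eq: "pt (neighbour x y) = pt u"
  then have "neighbour x y = u" using perm_point_eq arc_facts(5)[OF xy] u mem_interval by blast
  moreover have "neighbour x y (inv u x) = y" using permutes_inverses(1)[OF u] by simp
  ultimately show False using permutes_inverses(1)[OF u] arc_facts(3)[OF xy] by simp
qed

lemma face_vertices:
  assumes "e face_of Q"
  obtains S where "S \<subseteq> lower_interval CARD('n) w" "e = convex hull (pt ` S)"
proof -
  have "compact (pt ` lower_interval CARD('n) w)" using finite_interval by (simp add: finite_imp_compact)
  then obtain s where "s \<subseteq> pt ` lower_interval CARD('n) w" "e = convex hull s"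
    using assms face_of_convex_hull_subset unfolding bruhat_polytope_def by metis
  then show thesis using that by (metis subset_imageE)
qed

lemma segment_if_two_vertices:
  assumes e: "e face_of Q" and S: "pt u \<in> e" "pt v \<in> e"
    and two: "\<And>z. z \<in> lower_interval CARD('n) w \<Longrightarrow> pt z \<in> e \<Longrightarrow> z = u \<or> z = v"
  shows "e = closed_segment (pt u) (pt v)"
proof
  show "closed_segment (pt u) (pt v) \<subseteq> e"
    using S face_of_imp_convex[OF e] by (rule closed_segment_subset)
  obtain S where S: "S \<subseteq> lower_interval CARD('n) w" "e = convex hull (pt ` S)" using face_vertices[OF e] by blast
  have "pt ` S \<subseteq> {pt u, pt v}" using two S by (auto intro: hull_inc)
  then show "e \<subseteq> closed_segment (pt u) (pt v)"
    unfolding S(2) segment_convex_hull by (rule hull_mono)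
qed

text \<open>
  Collapsing a covering pair \<open>(a, b)\<close> leaves a partial order. Let \<open>F x\<close> be the number of elements
  reachable from \<open>x\<close> in it. This weight is equal on \<open>a\<close> and \<open>b\<close> and strictly decreasing along all other
  arcs, so the face where it is minimal has no vertices apart from \<open>u\<close> and its neighbour.
\<close>

lemma hasse_gives_edge:
  assumes h: "hasse A a b"
  shows "closed_segment (pt u) (pt (neighbour a b)) edge_of Q"
proof -
  have ab: "A a b" using h by (rule hasse_imp_step)
  note [simp] = rtranclp.rtrancl_refl
  let ?R = "A\<^sup>*\<^sup>*"
  \<comment> \<open>The set reachable from \<open>x\<close> when \<open>b\<close> is allowed to step back to \<open>a\<close>.\<close>
  define D where "D x = {z \<in> {1..CARD('n)}. ?R x z \<or> ?R x b \<and> ?R a z}" for x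
  define F where "F x = real (card (D x))" for x
  have fin: "finite (D x)" for x by (simp add: D_def)
  have R_eq: "?R x y \<longleftrightarrow> x = y \<or> A\<^sup>+\<^sup>+ x y" for x y by (metis rtranclpD rtranclp.rtrancl_refl tranclp_into_rtranclp)
  have "D a = D b"
    using ab unfolding D_def by (auto intro: rtranclp_trans converse_rtranclp_into_rtranclp)
  then have F_ab: "F a = F b" by (simp add: F_def)
  have sub: "D y \<subseteq> D x" if "A x y" for x y
    using that unfolding D_def by (auto intro: converse_rtranclp_into_rtranclp)
  have F: "F y \<le> F x" if "A x y" for x y
    unfolding F_def using card_mono[OF fin sub[OF that]] by simp
  have strict: "F y < F x" if xy: "A x y" and ne: "(x, y) \<noteq> (a, b)" for x y
  proof -
    have "x \<in> D x" using arc_facts(1)[OF xy] by (simp add: D_def)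
    moreover have "x \<notin> D y"
    proof
      assume "x \<in> D y"
      then consider "?R y x" | "?R y b" "?R a x" by (auto simp: D_def)
      then show False
      proof cases
        case 1
        then have "A\<^sup>+\<^sup>+ x x" using xy by (metis R_eq tranclp.r_into_trancl tranclp_trans)
        then show False using path_pos by blast
      next
        case 2
        then show False using xy ne h unfolding R_eq hasse_def
          by (metis tranclp.r_into_trancl tranclp_trans)
      qed
    qed
    ultimately have "D y \<subset> D x" using sub[OF xy] by blast
    then show ?thesis unfolding F_def using psubset_card_mono[OF fin] by simp
  qed
  define c :: "real ^ 'n::{finite,linorder}" where "c = (\<chi> i. F (coord_num i))"
  have c: "c \<bullet> pt v = (\<Sum>x\<in>{1..CARD('n)}. F x * real (inv v x))" for v
    unfolding c_def by (rule inner_perm_point)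
  have ge: "c \<bullet> pt u \<le> c \<bullet> pt v" if "v \<in> lower_interval CARD('n) w" for v
    unfolding c using that weight_minimal[OF u _ w dom _ F] by (simp add: mem_interval)
  have two: "v = u \<or> v = neighbour a b" if v: "v \<in> lower_interval CARD('n) w" "c \<bullet> pt v = c \<bullet> pt u" for v
  proof (rule agree_off_pair[OF u])
    show "v permutes {1..CARD('n)}" using v by (simp add: mem_interval)
    show "a \<in> {1..CARD('n)}" "b \<in> {1..CARD('n)}" "a \<noteq> b" using arc_facts[OF ab] by auto
    fix m assume m: "m \<noteq> a" "m \<noteq> b"
    show "inv v m = inv u m"
    proof (rule weight_minimal_coordinate[OF u _ w dom])
      show "v permutes {1..CARD('n)}" "dominated v w" using v by (auto simp: mem_interval)
      show "F y \<le> F x" if "A x y" for x y using that by (rule F)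
      show "F y < F x" if "A x y" "x = m \<or> y = m" for x y using strict[OF that(1)] that(2) m by auto
      show "(\<Sum>x\<in>{1..CARD('n)}. F x * real (inv u x)) = (\<Sum>x\<in>{1..CARD('n)}. F x * real (inv v x))"
        using v(2) unfolding c by simp
    qed
  qed
  let ?e = "Q \<inter> {p. c \<bullet> p = c \<bullet> pt u}"
  have "Q \<subseteq> {p. c \<bullet> p \<ge> c \<bullet> pt u}"
    unfolding bruhat_polytope_def using ge by (intro hull_minimal convex_halfspace_ge) auto
  then have face: "?e face_of Q"
    by (intro face_of_Int_supporting_hyperplane_ge) (auto simp: bruhat_polytope_def)
  have "?e = closed_segment (pt u) (pt (neighbour a b))"
  proof (rule segment_if_two_vertices[OF face])
    show "pt u \<in> ?e" using pt_in_Q[OF vertex_in_interval] by simp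
    have "c \<bullet> pt (neighbour a b) = c \<bullet> pt u"
      unfolding c using weight_swap[OF u, of a b F] arc_facts[OF ab] F_ab by simp
    then show "pt (neighbour a b) \<in> ?e" using pt_in_Q arc_facts(5)[OF ab] by simp
    show "z = u \<or> z = neighbour a b" if "z \<in> lower_interval CARD('n) w" "pt z \<in> ?e" for z using two that by simp
  qed
  then show ?thesis
    using face pt_neighbour_neq[OF ab] unfolding edge_of_def segment_convex_hull aff_dim_convex_hull
    by simp
qed

text \<open>
  All points of the edge lie on the line through the two given vertices, so they agree with \<open>u\<close> in the
  coordinates other than \<open>x\<close> and \<open>y\<close>.
\<close>

lemma edge_determined_by_arc:
  assumes e: "e edge_of Q" "pt u \<in> e" and xy: "A x y" "pt (neighbour x y) \<in> e"
  shows "e = closed_segment (pt u) (pt (neighbour x y))"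
proof (rule segment_if_two_vertices)
  show face: "e face_of Q" using e by (simp add: edge_of_def)
  show "pt u \<in> e" "pt (neighbour x y) \<in> e" by fact+
  have "affine hull {pt u, pt (neighbour x y)} = affine hull e"
  proof (rule affine_dim_equal)
    show "affine hull {pt u, pt (neighbour x y)} \<subseteq> affine hull e"
      using e xy by (intro hull_mono) auto
    show "aff_dim (affine hull {pt u, pt (neighbour x y)}) = aff_dim (affine hull e)"
      using e(1) pt_neighbour_neq[OF xy(1)] by (simp add: edge_of_def)
  qed auto
  then have line: "e \<subseteq> affine hull {pt u, pt (neighbour x y)}" by (simp add: hull_subset)
  fix z assume z: "z \<in> lower_interval CARD('n) w" "pt z \<in> e"
  obtain s t where st: "s + t = 1" "pt z = s *\<^sub>R pt u + t *\<^sub>R pt (neighbour x y)"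
    using line z(2) unfolding affine_hull_2 by blast
  show "z = u \<or> z = neighbour x y"
  proof (rule agree_off_pair[OF u])
    show zp: "z permutes {1..CARD('n)}" using z by (simp add: mem_interval)
    show "x \<in> {1..CARD('n)}" "y \<in> {1..CARD('n)}" "x \<noteq> y" using arc_facts[OF xy(1)] by auto
    fix m assume m: "m \<noteq> x" "m \<noteq> y"
    show "inv z m = inv u m"
    proof (cases "m \<in> {1..CARD('n)}")
      case True
      then obtain i where i: "\<And>u. pt u $ i = real (inv u m)"
        using perm_point_nth[where 'n = 'n] by metis
      have "real (inv z m) = s * real (inv u m) + t * real (inv u m)"
        using arg_cong[OF st(2), of "\<lambda>p. p $ i"] m by (simp add: i inv_swap_left[OF u])
      also have "\<dots> = real (inv u m)" using st(1) by (metis distrib_right mult_1)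
      finally show ?thesis by simp
    next
      case False
      then show ?thesis using permutes_inv[OF u] permutes_inv[OF zp] by (simp add: permutes_not_in)
    qed
  qed
qed

text \<open>
  Take a functional that exposes the edge; its weight \<open>F\<close> decreases weakly along arcs. If it were strictly
  decreasing along all of them, \<open>u\<close> would be the only vertex of the face. So it is constant along some arc
  \<open>a \<rightarrow> b\<close>, whose neighbour spans the edge. If \<open>(a, b)\<close> were not a covering pair, \<open>F\<close> would also be constant
  along another arc \<open>a \<rightarrow> y\<close>, and the edge would contain two neighbours of \<open>u\<close>.
\<close>

lemma edge_gives_hasse:
  assumes e: "e edge_of Q" "pt u \<in> e"
  obtains a b where "hasse A a b" "e = closed_segment (pt u) (pt (neighbour a b))"
proof -
  have face: "e face_of Q" and dim: "aff_dim e = 1" using e by (auto simp: edge_of_def)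
  have "polyhedron Q" unfolding bruhat_polytope_def using finite_interval by (simp add: polyhedron_convex_hull)
  then obtain c d where cd: "Q \<subseteq> {p. c \<bullet> p \<le> d}" "e = Q \<inter> {p. c \<bullet> p = d}"
    using face exposed_face_of_polyhedron[of Q e] unfolding exposed_face_of_def by blast
  obtain F where F: "- c = (\<chi> i. F (coord_num i))" using every_functional by blast
  define W where "W v = (\<Sum>x\<in>{1..CARD('n)}. F x * real (inv v x))" for v
  have W: "c \<bullet> pt v = - W v" for v
    using inner_perm_point[of F v, where 'n = 'n] unfolding F[symmetric] W_def by simp
  have W_ge: "W u \<le> W v" and W_eq: "pt v \<in> e \<longleftrightarrow> W v = W u" if "v \<in> lower_interval CARD('n) w" for v
    using cd e(2) pt_in_Q[OF that] W[of v] W[of u] by auto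
  have W_arc: "W (neighbour x y) = W u + (F x - F y) * (real (inv u y) - real (inv u x))" if "A x y" for x y
    unfolding W_def using arc_facts[OF that] by (intro weight_swap[OF u]) auto
  have mono: "F y \<le> F x" if xy: "A x y" for x y
  proof (rule ccontr)
    assume "\<not> F y \<le> F x"
    then have "(F x - F y) * (real (inv u y) - real (inv u x)) < 0"
      using arc_facts(4)[OF xy] by (intro mult_neg_pos) auto
    then show False using W_ge[OF arc_facts(5)[OF xy]] W_arc[OF xy] by simp
  qed
  have on_edge: "e = closed_segment (pt u) (pt (neighbour x y))" if "A x y" "F x = F y" for x y
    using edge_determined_by_arc[OF e that(1)] W_eq[OF arc_facts(5)[OF that(1)]] W_arc[OF that(1)] that(2) by simp
  have "\<exists>a b. A a b \<and> F a = F b"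
  proof (rule ccontr)
    assume no: "\<nexists>a b. A a b \<and> F a = F b"
    have "v = u" if v: "v \<in> lower_interval CARD('n) w" "pt v \<in> e" for v
    proof (rule permutation_from_inverse)
      show "v permutes {1..CARD('n)}" "u permutes {1..CARD('n)}" using v u by (auto simp: mem_interval)
      show "inv v m = inv u m" for m
      proof (rule weight_minimal_coordinate[OF u _ w dom _ mono])
        show "v permutes {1..CARD('n)}" "dominated v w" using v by (auto simp: mem_interval)
        show "F y < F x" if "A x y" for x y using mono[OF that] no that by fastforce
        show "(\<Sum>x\<in>{1..CARD('n)}. F x * real (inv u x)) = (\<Sum>x\<in>{1..CARD('n)}. F x * real (inv v x))"
          using W_eq[OF v(1)] v(2) by (simp add: W_def)
      qed
    qed
    then have "e = closed_segment (pt u) (pt u)" using segment_if_two_vertices[OF face e(2) e(2)] by blast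
    then show False using dim by simp
  qed
  then obtain a b where ab: "A a b" "F a = F b" by blast
  have path: "F y \<le> F x" if "A\<^sup>+\<^sup>+ x y" for x y
    using that by (induction rule: tranclp_induct) (auto intro: mono order_trans)
  have "False" if z: "A\<^sup>+\<^sup>+ a z" "A\<^sup>+\<^sup>+ z b" for z
  proof -
    obtain y where y: "A a y" "y = z \<or> A\<^sup>+\<^sup>+ y z"
      using z(1) by (metis tranclpD rtranclpD)
    then have yb: "A\<^sup>+\<^sup>+ y b" using z(2) by (metis tranclp_trans)
    have "F a = F y" using path[OF yb] mono[OF y(1)] ab(2) by simp
    then have "closed_segment (pt u) (pt (neighbour a y)) = closed_segment (pt u) (pt (neighbour a b))"
      using on_edge[OF y(1)] on_edge[OF ab] by simp
    then have "pt (neighbour a y) = pt (neighbour a b)" by (auto simp: doubleton_eq_iff)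
    then have "neighbour a y = neighbour a b"
      using perm_point_eq arc_facts(5)[OF y(1)] arc_facts(5)[OF ab(1)] mem_interval by blast
    then have "neighbour a y (inv u a) = neighbour a b (inv u a)" by simp
    then have "y = b" using permutes_inverses(1)[OF u] by simp
    then show False using path_pos[OF yb] by simp
  qed
  then have "hasse A a b" using ab(1) unfolding hasse_def by blast
  then show thesis using that on_edge[OF ab] by blast
qed

lemma segments_inj:
  assumes xy: "A x y" and xy': "A x' y'"
    and eq: "closed_segment (pt u) (pt (neighbour x y)) = closed_segment (pt u) (pt (neighbour x' y'))"
  shows "x = x' \<and> y = y'"
proof -
  have "pt (neighbour x y) = pt (neighbour x' y')" using eq by (auto simp: doubleton_eq_iff)
  then have n: "neighbour x y = neighbour x' y'"
    using perm_point_eq arc_facts(5)[OF xy] arc_facts(5)[OF xy'] mem_interval by blast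
  have t: "swap x y z = swap x' y' z" for z
    using fun_cong[OF n, of "inv u z"] permutes_inverses(1)[OF u] by simp
  have "x' \<in> {x, y}" "y' \<in> {x, y}"
    using t[of x'] t[of y'] arc_facts(3)[OF xy'] by (auto simp: Transposition.transpose_def split: if_splits)
  then show ?thesis using arc_facts(3,4)[OF xy] arc_facts(3,4)[OF xy'] by auto
qed

theorem vertex_degree_eq: "vertex_degree w (pt u) = card {(a, b). hasse A a b}"
proof -
  let ?seg = "\<lambda>(a, b). closed_segment (pt u) (pt (neighbour a b))"
  have "inj_on ?seg {(a, b). hasse A a b}"
  proof (rule inj_onI)
    fix e e' assume "e \<in> {(a, b). hasse A a b}" "e' \<in> {(a, b). hasse A a b}" "?seg e = ?seg e'"
    then show "e = e'"
      using segments_inj hasse_imp_step[of A] by (cases e, cases e') (simp del: closed_segment_eq, blast)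
  qed
  moreover have "{e. e edge_of Q \<and> pt u \<in> e} = ?seg ` {(a, b). hasse A a b}"
  proof (intro set_eqI iffI)
    fix e assume "e \<in> {e. e edge_of Q \<and> pt u \<in> e}"
    then show "e \<in> ?seg ` {(a, b). hasse A a b}" using edge_gives_hasse[of e] by blast
  next
    fix e assume "e \<in> ?seg ` {(a, b). hasse A a b}"
    then show "e \<in> {e. e edge_of Q \<and> pt u \<in> e}" using hasse_gives_edge by auto
  qed
  ultimately show ?thesis unfolding vertex_degree_def by (simp add: card_image)
qed

end

text \<open>
  The edge exchanges the values of a covering pair \<open>(a, b)\<close>, and as the length grows, this pair was no
  inversion.
\<close>

lemma vertex_degree_mono_cover:
  assumes w: "w permutes {1..CARD('n::{finite,linorder})}" and cover: "skeleton_cover TYPE('n) w u v"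
  shows "vertex_degree w (perm_point u :: real ^ 'n::{finite,linorder}) \<le> vertex_degree w (perm_point v :: real ^ 'n::{finite,linorder})"
proof -
  have uv: "u \<in> lower_interval CARD('n) w" "v \<in> lower_interval CARD('n) w"
    and edge: "closed_segment (perm_point u) (perm_point v :: real ^ 'n::{finite,linorder}) edge_of bruhat_polytope w"
    and len: "coxeter_length CARD('n) u < coxeter_length CARD('n) v"
    using cover by (auto simp: skeleton_cover_def)
  have u: "u permutes {1..CARD('n)}" "dominated u w" and v: "v permutes {1..CARD('n)}" "dominated v w"
    using uv by (auto simp: lower_interval_eq[OF w])
  interpret U: bruhat_vertex "TYPE('n)" u w using u w by unfold_locales
  interpret V: bruhat_vertex "TYPE('n)" v w using v w by unfold_locales
  obtain a b where ab: "hasse (perm_arc u w) a b"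
    "closed_segment (perm_point u) (perm_point v :: real ^ 'n::{finite,linorder}) =
      closed_segment (perm_point u) (perm_point (swap a b \<circ> u))"
    using U.edge_gives_hasse[OF edge] by auto
  have exch_arc: "perm_arc u w a b" using ab(1) by (rule hasse_imp_step)
  note facts = U.arc_facts[OF exch_arc]
  have "(perm_point v :: real ^ 'n::{finite,linorder}) = perm_point (swap a b \<circ> u)"
    using ab(2) by (auto simp: doubleton_eq_iff)
  then have v_eq: "v = swap a b \<circ> u"
    using perm_point_eq[where 'n = 'n] v(1) facts(5) U.mem_interval by blast
  have "a < b"
  proof (rule ccontr)
    assume "\<not> a < b"
    let ?p = "inv u a" and ?q = "inv u b"
    have pq: "?p \<in> {1..CARD('n)}" "?q \<in> {1..CARD('n)}"
      using facts(1,2) permutes_in_image[OF permutes_inv[OF u(1)]] by blast+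
    have v': "v = u \<circ> swap ?p ?q" unfolding v_eq by (rule swap_left[OF u(1)])
    have "v ?p < v ?q"
      using \<open>\<not> a < b\<close> facts(3) permutes_inverses(1)[OF u(1)] by (simp add: v')
    then have "card (inversions v) < card (inversions (v \<circ> swap ?p ?q))"
      using card_inversions_less[OF v(1) pq facts(4)] by simp
    moreover have "v \<circ> swap ?p ?q = u" by (simp add: v' comp_assoc)
    ultimately show False using len coxeter_length_eq_inversions u(1) v(1) by simp
  qed
  then show ?thesis
    using card_hasse_perm_arc_mono[OF u(1) w u(2) ab(1)]
    unfolding U.vertex_degree_eq V.vertex_degree_eq by (simp add: v_eq)
qed

theorem theorem6p1:
  fixes w u v :: "nat \<Rightarrow> nat"
  assumes "w permutes {1..CARD('n::{finite,linorder})}"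
    and "u \<in> lower_interval CARD('n) w"
    and "v \<in> lower_interval CARD('n) w"
    and "skeleton_le TYPE('n) w u v"
  shows
   "vertex_degree w (perm_point u :: real ^ 'n::{finite,linorder})
    \<le> vertex_degree w (perm_point v :: real ^ 'n::{finite,linorder})"
  using assms(4) unfolding skeleton_le_def
proof (induction rule: rtranclp_induct)
  case base
  show ?case by simp
next
  case (step y z)
  then show ?case using vertex_degree_mono_cover[OF assms(1)] order_trans by blast
qed

end
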